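(* Let $\mathcal{F}=C^\infty(\mathbb{R})$. The Green's function of any regular Stieltjes boundary problem over $\mathcal{F}$ with $m$ evaluations $\alpha_1<\dots<\alpha_m$ has the form $$g(x,\xi)=\tilde g(x,\xi)+\hat g(x,\xi),$$ where the functional part $\tilde g\in C(J^2)$ is defined by the $2(m-1)$ case branches $$\xi\in[\alpha_i,\alpha_{i+1}]\ (0<i<m),\ x\le\xi;\qquad\qquad \xi\in[\alpha_i,\alpha_{i+1}]\ (0<i<m),\ \xi\le x,$$ while the distributional part $\hat g(x,\xi)$ is an $\mathcal{F}$-linear combination (with coefficients being functions of $x$) of the Dirac distributions $\delta(\xi-\alpha_i)$ and their derivatives. Here $J\subset\mathbb{R}$ is an interval containing all the evaluation points $\alpha_1,\dots,\alpha_m$.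
   Context: Setting. $\mathcal{F}=C^\infty(\mathbb{R})$ is the algebra of real- or complex-valued smooth functions over the corresponding field $K$ ($\mathbb{R}$ or $\mathbb{C}$), with derivation $\partial=d/dx$ and distinguished integral $\int=\int_0^x$. $C(J^2)$ denotes the continuous functions on $J^2$. For $\alpha\in\mathbb{R}$, $\lfloor\alpha\rfloor$ denotes the evaluation $f\mapsto f(\alpha)$, and $\int_\alpha$ denotes the operator $f\mapsto\int_\alpha^x f(\xi)\,d\xi$. Stieltjes conditions. A Stieltjes condition is a linear functional on $\mathcal{F}$ of the form $$\beta(u)=\sum_{\phi,i}a_{\phi,i}\,u^{(i)}(\phi)+\sum_{\phi}\int_0^\phi f_\phi(\xi)\,u(\xi)\,d\xi,$$ where $\phi$ ranges over evaluation points in $\mathbb{R}$, $i$ over nonnegative integers, and only finitely many $a_{\phi,i}\in K$ and $f_\phi\in\mathcal{F}$ are nonzero. Boundary problems. A Stieltjes boundary problem of order $n$ is a pair $(T,\mathcal{B})$, where $T$ is a monic linear differential operator of order $n$ with coefficients in $\mathcal{F}$ and $\mathcal{B}=[\beta_1,\dots,\beta_n]$ is the linear span of $n$ linearly independent Stieltjes conditions (derivatives of arbitrary order are allowed). It is regular if for every $f\in\mathcal{F}$ there is a unique $u\in\mathcal{F}$ with $Tu=f$ and $\beta_1(u)=\dots=\beta_n(u)=0$; its Green's operator is then the map $G\colon\mathcal{F}\to\mathcal{F}$, $f\mapsto u$. The evaluations $\alpha_1,\dots,\alpha_m$ of the problem are the evaluation points used in its boundary conditions. Green's function. The Green's function is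 the kernel $g(x,\xi)=G_{x\xi}$ corresponding to $G$, so that $(Gf)(x)=\int_J g(x,\xi)\,f(\xi)\,d\xi$; it may contain Dirac distributions, where $\int_J\delta(\xi-\alpha)f(\xi)\,d\xi=f(\alpha)$. It is obtained by writing $G$ as a sum of operators of the forms $f\int_\alpha g$ and $f\lfloor\alpha\rfloor\partial^i$ with $f,g\in\mathcal{F}$ (functions acting by multiplication) and applying the linear assignment $$\Big(f\textstyle\int_\alpha g\Big)_{x\xi}=f(x)\,g(\xi)\,[\alpha\le\xi\le x]-f(x)\,g(\xi)\,[x\le\xi\le\alpha],\qquad (f\lfloor\alpha\rfloor\partial^i)_{x\xi}=(-1)^i f(x)\,\delta^{(i)}(\xi-\alpha),$$ where $[P]$ is $1$ if $P$ holds and $0$ otherwise.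
   Formalization: Continuity on J² holds for each case branch, not for g̃ itself, which may jump at x=ξ or ξ=α_i; g is determined up to finitely many ξ per x; 0 counts as an evaluation if an integral term occurs; extra branches describe ξ outside [α_1,α_m]; the order n is at least 1. *)

theory Defs
  imports "HOL-Analysis.Analysis"
begin

text \<open>
  The ground field is a type \<open>'k\<close> of class \<open>{real_normed_field, euclidean_space}\<close>: a finite-dimensional
  real normed field. Up to isometric isomorphism these are exactly \<open>real\<close> and \<open>complex\<close>, and both
  types are instances.
\<close>

definition ddx :: "(real \<Rightarrow> 'k::real_normed_vector) \<Rightarrow> real \<Rightarrow> 'k" where
  "ddx u = (\<lambda>x. vector_derivative u (at x))"

definition smooth :: "(real \<Rightarrow> 'k::real_normed_vector) \<Rightarrow> bool" where
  "smooth u \<longleftrightarrow> (\<forall>i x. ((ddx ^^ i) u) differentiable (at x))"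

record 'k stieltjes =
  local_coeff :: "real \<Rightarrow> nat \<Rightarrow> 'k"
  weight :: "real \<Rightarrow> real \<Rightarrow> 'k"

definition local_support :: "'k::{real_normed_field,euclidean_space} stieltjes \<Rightarrow> (real \<times> nat) set" where
  "local_support \<beta> = {(\<phi>, i). local_coeff \<beta> \<phi> i \<noteq> 0}"

definition global_support :: "'k::{real_normed_field,euclidean_space} stieltjes \<Rightarrow> real set" where
  "global_support \<beta> = {\<phi>. weight \<beta> \<phi> \<noteq> (\<lambda>_. 0)}"

definition stieltjes_condition :: "'k::{real_normed_field,euclidean_space} stieltjes \<Rightarrow> bool" where
  "stieltjes_condition \<beta> \<longleftrightarrow>
     finite (local_support \<beta>) \<and> finite (global_support \<beta>) \<and> (\<forall>\<phi>. smooth (weight \<beta> \<phi>))"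

definition stieltjes_apply ::
  "'k::{real_normed_field,euclidean_space} stieltjes \<Rightarrow> (real \<Rightarrow> 'k) \<Rightarrow> 'k" where
  "stieltjes_apply \<beta> u =
     (\<Sum>(\<phi>, i)\<in>local_support \<beta>. local_coeff \<beta> \<phi> i * (ddx ^^ i) u \<phi>)
   + (\<Sum>\<phi>\<in>global_support \<beta>. LBINT \<xi>=ereal 0..ereal \<phi>. weight \<beta> \<phi> \<xi> * u \<xi>)"

text \<open>
  An integral from 0 to \<open>\<phi>\<close> uses both of its end points, so 0 counts as an evaluation point as soon
  as there is an integral term. For example, if \<open>u' = f\<close> and the integral of \<open>u\<close> over \<open>{0..1}\<close>
  vanishes, then \<open>u(1)\<close> is the integral of \<open>\<xi> f(\<xi>)\<close> over \<open>{0..1}\<close>, so that 1 alone does not suffice.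
\<close>

definition eval_points :: "'k::{real_normed_field,euclidean_space} stieltjes \<Rightarrow> real set" where
  "eval_points \<beta> = fst ` local_support \<beta> \<union> global_support \<beta>
     \<union> (if global_support \<beta> = {} then {} else {0})"

text \<open>The list \<open>cs\<close> contains the coefficients of orders \<open>0, \<dots>, n - 1\<close>; the leading coefficient is 1.\<close>

definition diff_op ::
  "(real \<Rightarrow> 'k::{real_normed_field,euclidean_space}) list \<Rightarrow> (real \<Rightarrow> 'k) \<Rightarrow> real \<Rightarrow> 'k" where
  "diff_op cs u = (\<lambda>x. (ddx ^^ length cs) u x + (\<Sum>i<length cs. (cs ! i) x * (ddx ^^ i) u x))"

definition boundary_problem ::
  "nat \<Rightarrow> (real \<Rightarrow> 'k::{real_normed_field,euclidean_space}) list \<Rightarrow> 'k stieltjes list \<Rightarrow> bool" where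
  "boundary_problem n cs \<beta>s \<longleftrightarrow>
     length cs = n \<and> length \<beta>s = n \<and>
     (\<forall>c\<in>set cs. smooth c) \<and> (\<forall>\<beta>\<in>set \<beta>s. stieltjes_condition \<beta>) \<and>
     (\<forall>a :: nat \<Rightarrow> 'k. (\<forall>u. smooth u \<longrightarrow> (\<Sum>k<n. a k * stieltjes_apply (\<beta>s ! k) u) = 0)
        \<longrightarrow> (\<forall>k<n. a k = 0))"

definition solves ::
  "(real \<Rightarrow> 'k::{real_normed_field,euclidean_space}) list \<Rightarrow> 'k stieltjes list
     \<Rightarrow> (real \<Rightarrow> 'k) \<Rightarrow> (real \<Rightarrow> 'k) \<Rightarrow> bool" where
  "solves cs \<beta>s f u \<longleftrightarrow> smooth u \<and> diff_op cs u = f \<and> (\<forall>\<beta>\<in>set \<beta>s. stieltjes_apply \<beta> u = 0)"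

definition regular_problem ::
  "(real \<Rightarrow> 'k::{real_normed_field,euclidean_space}) list \<Rightarrow> 'k stieltjes list \<Rightarrow> bool" where
  "regular_problem cs \<beta>s \<longleftrightarrow> (\<forall>f. smooth f \<longrightarrow> (\<exists>!u. solves cs \<beta>s f u))"

definition greens_operator ::
  "(real \<Rightarrow> 'k::{real_normed_field,euclidean_space}) list \<Rightarrow> 'k stieltjes list
     \<Rightarrow> (real \<Rightarrow> 'k) \<Rightarrow> real \<Rightarrow> 'k" where
  "greens_operator cs \<beta>s f = (THE u. solves cs \<beta>s f u)"

text \<open>
  A kernel is a sum of a function of \<open>(x, \<xi>)\<close> and a linear combination of Dirac distributions. It is
  represented by a pair \<open>(k, d)\<close>, where \<open>d \<alpha> i\<close> is the coefficient, a function of \<open>x\<close>, of the \<open>i\<close>-th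
  derivative of \<open>\<delta>(\<xi> - \<alpha>)\<close>.
\<close>

type_synonym 'k dirac_part = "real \<Rightarrow> nat \<Rightarrow> real \<Rightarrow> 'k"
type_synonym 'k kernel = "(real \<Rightarrow> real \<Rightarrow> 'k) \<times> 'k dirac_part"

definition dirac :: "(real \<Rightarrow> 'k::{real_normed_field,euclidean_space}) \<Rightarrow> real \<Rightarrow> nat \<Rightarrow> 'k dirac_part" where
  "dirac c \<alpha> i = (\<lambda>\<beta> j x. if \<beta> = \<alpha> \<and> j = i then c x else 0)"

text \<open>\<open>IntegOp f \<alpha> g\<close> stands for \<open>f \<integral>\<^sub>\<alpha> g\<close>, and \<open>EvalOp f \<alpha> i\<close> for \<open>f \<lfloor>\<alpha>\<rfloor> \<partial>\<^sup>i\<close>.\<close>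

datatype 'k elem_op =
    IntegOp "real \<Rightarrow> 'k" real "real \<Rightarrow> 'k"
  | EvalOp "real \<Rightarrow> 'k" real nat

fun smooth_op :: "'k::{real_normed_field,euclidean_space} elem_op \<Rightarrow> bool" where
  "smooth_op (IntegOp f \<alpha> g) \<longleftrightarrow> smooth f \<and> smooth g"
| "smooth_op (EvalOp f \<alpha> i) \<longleftrightarrow> smooth f"

fun op_apply :: "'k::{real_normed_field,euclidean_space} elem_op \<Rightarrow> (real \<Rightarrow> 'k) \<Rightarrow> real \<Rightarrow> 'k" where
  "op_apply (IntegOp f \<alpha> g) u = (\<lambda>x. f x * (LBINT \<xi>=ereal \<alpha>..ereal x. g \<xi> * u \<xi>))"
| "op_apply (EvalOp f \<alpha> i) u = (\<lambda>x. f x * (ddx ^^ i) u \<alpha>)"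

fun op_kernel :: "'k::{real_normed_field,euclidean_space} elem_op \<Rightarrow> 'k kernel" where
  "op_kernel (IntegOp f \<alpha> g) =
     (\<lambda>x \<xi>. f x * g \<xi> * of_bool (\<alpha> \<le> \<xi> \<and> \<xi> \<le> x) - f x * g \<xi> * of_bool (x \<le> \<xi> \<and> \<xi> \<le> \<alpha>),
      \<lambda>\<beta> j x. 0)"
| "op_kernel (EvalOp f \<alpha> i) = (\<lambda>x \<xi>. 0, dirac (\<lambda>x. (-1) ^ i * f x) \<alpha> i)"

definition kernel_of :: "'k::{real_normed_field,euclidean_space} elem_op list \<Rightarrow> 'k kernel" where
  "kernel_of ops =
     (\<lambda>x \<xi>. \<Sum>p\<leftarrow>ops. fst (op_kernel p) x \<xi>, \<lambda>\<alpha> i x. \<Sum>p\<leftarrow>ops. snd (op_kernel p) \<alpha> i x)"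

text \<open>\<open>kernel_integral J g f x\<close> is the integral of \<open>g(x, \<xi>) f(\<xi>)\<close> over \<open>\<xi> \<in> J\<close>, where \<open>\<delta>(\<xi> - \<alpha>)\<close>
  contributes fully also if \<open>\<alpha>\<close> is an end point of \<open>J\<close>.\<close>

definition kernel_integral ::
  "real set \<Rightarrow> 'k::{real_normed_field,euclidean_space} kernel \<Rightarrow> (real \<Rightarrow> 'k) \<Rightarrow> real \<Rightarrow> 'k" where
  "kernel_integral J g f x =
     (LBINT \<xi>:J. fst g x \<xi> * f \<xi>)
   + (\<Sum>(\<alpha>, i)\<in>{(\<alpha>, i). \<alpha> \<in> J \<and> snd g \<alpha> i x \<noteq> 0}. snd g \<alpha> i x * ((-1) ^ i * (ddx ^^ i) f \<alpha>))"

definition greens_function ::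
  "real set \<Rightarrow> (real \<Rightarrow> 'k::{real_normed_field,euclidean_space}) list \<Rightarrow> 'k stieltjes list
     \<Rightarrow> 'k kernel \<Rightarrow> bool" where
  "greens_function J cs \<beta>s g \<longleftrightarrow>
     (\<exists>ops. (\<forall>p\<in>set ops. smooth_op p) \<and>
        (\<forall>f. smooth f \<longrightarrow> greens_operator cs \<beta>s f = (\<lambda>x. \<Sum>p\<leftarrow>ops. op_apply p f x)) \<and>
        g = kernel_of ops) \<and>
     (\<forall>f. smooth f \<longrightarrow> (\<forall>x\<in>J. set_integrable lborel J (\<lambda>\<xi>. fst g x \<xi> * f \<xi>) \<and>
        greens_operator cs \<beta>s f x = kernel_integral J g f x))"

text \<open>
  Equality of kernels on \<open>J \<times> J\<close> as distributions in \<open>\<xi>\<close>. Different ways of writing the Green's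
  operator as a sum of elementary operators produce functional parts that may differ, for each
  \<open>x\<close>, at finitely many \<open>\<xi>\<close>.
\<close>

definition kernel_eq ::
  "real set \<Rightarrow> 'k::{real_normed_field,euclidean_space} kernel \<Rightarrow> 'k kernel \<Rightarrow> bool" where
  "kernel_eq J g h \<longleftrightarrow>
     (\<forall>x\<in>J. finite {\<xi>\<in>J. fst g x \<xi> \<noteq> fst h x \<xi>} \<and> (\<forall>\<alpha> i. snd g \<alpha> i x = snd h \<alpha> i x))"

text \<open>
  Two adjacent branches have different values in general on the line that they share (the diagonal
  \<open>\<xi> = x\<close> or a line \<open>\<xi> = \<alpha>\<^sub>i\<close>), so each branch prescribes the function in the interior of its region
  only. Continuity is a property of the branch expressions: the kernel of \<open>u' = f\<close>,
  \<open>u(0) + u(1) = 0\<close> is \<open>1/2\<close> for \<open>\<xi> < x\<close> and \<open>-1/2\<close> for \<open>x < \<xi>\<close>.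
\<close>

definition case_branches ::
  "real list \<Rightarrow> real set \<Rightarrow> (real \<Rightarrow> real \<Rightarrow> 'k::{real_normed_field,euclidean_space}) \<Rightarrow> bool" where
  "case_branches \<alpha>s J h \<longleftrightarrow>
     (\<exists>l r :: nat \<Rightarrow> real \<Rightarrow> real \<Rightarrow> 'k. \<forall>i. Suc i < length \<alpha>s \<longrightarrow>
        continuous_on (J \<times> J) (\<lambda>(x, \<xi>). l i x \<xi>) \<and>
        continuous_on (J \<times> J) (\<lambda>(x, \<xi>). r i x \<xi>) \<and>
        (\<forall>x\<in>J. \<forall>\<xi>\<in>{\<alpha>s ! i <..< \<alpha>s ! Suc i}.
           (x < \<xi> \<longrightarrow> h x \<xi> = l i x \<xi>) \<and> (\<xi> < x \<longrightarrow> h x \<xi> = r i x \<xi>)))"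

text \<open>
  If \<open>J\<close> extends beyond the extreme evaluation points, then the function is not zero there in
  general, but it vanishes unless \<open>\<xi>\<close> lies between \<open>x\<close> and the evaluation points.
  The condition is void for \<open>J = {hd \<alpha>s..last \<alpha>s}\<close>.
\<close>

definition outer_branches ::
  "real list \<Rightarrow> real set \<Rightarrow> (real \<Rightarrow> real \<Rightarrow> 'k::{real_normed_field,euclidean_space}) \<Rightarrow> bool" where
  "outer_branches \<alpha>s J h \<longleftrightarrow>
     (\<exists>l r :: real \<Rightarrow> real \<Rightarrow> 'k.
        continuous_on (J \<times> J) (\<lambda>(x, \<xi>). l x \<xi>) \<and>
        continuous_on (J \<times> J) (\<lambda>(x, \<xi>). r x \<xi>) \<and>
        (\<forall>x\<in>J. \<forall>\<xi>\<in>J.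
           (\<xi> < hd \<alpha>s \<longrightarrow> (x < \<xi> \<longrightarrow> h x \<xi> = l x \<xi>) \<and> (\<xi> < x \<longrightarrow> h x \<xi> = 0)) \<and>
           (last \<alpha>s < \<xi> \<longrightarrow> (x < \<xi> \<longrightarrow> h x \<xi> = 0) \<and> (\<xi> < x \<longrightarrow> h x \<xi> = r x \<xi>))))"

definition dirac_combination ::
  "real list \<Rightarrow> 'k::{real_normed_field,euclidean_space} dirac_part \<Rightarrow> bool" where
  "dirac_combination \<alpha>s d \<longleftrightarrow>
     (\<exists>N (c :: nat \<Rightarrow> nat \<Rightarrow> real \<Rightarrow> 'k).
        (\<forall>i<length \<alpha>s. \<forall>j<N. smooth (c i j)) \<and>
        d = (\<lambda>\<beta> k x. \<Sum>i<length \<alpha>s. \<Sum>j<N. dirac (c i j) (\<alpha>s ! i) j \<beta> k x))"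

end

theory Submission
  imports Defs "Jordan_Normal_Form.Determinant"
begin

text \<open>
  The Green's operator of a regular Stieltjes boundary problem is computed in the classical way. Let
  \<open>u\<^sub>1, \<dots>, u\<^sub>n\<close> be a fundamental system of \<open>T u = 0\<close>. Variation of constants yields functions \<open>v\<^sub>j\<close> such
  that \<open>f \<mapsto> \<Sum>\<^sub>j u\<^sub>j \<integral>\<^sub>a v\<^sub>j f\<close> is a right inverse of \<open>T\<close>, with a base point \<open>a\<close> that is chosen among the
  evaluation points (\<open>variation_of_constants\<close>). The Green's operator differs from it by a combination of
  the \<open>u\<^sub>j\<close>, whose coefficients are linear combinations of the boundary conditions applied to the right
  inverse (\<open>green_form_greens_operator\<close>). Applying a Stieltjes condition to \<open>u\<^sub>j \<integral>\<^sub>a v\<^sub>j f\<close> gives, by the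
  Leibniz rule and by integration by parts, only derivatives of \<open>f\<close> at evaluation points and integrals
  of \<open>f\<close> against smooth functions between evaluation points (\<open>green_form_stieltjes\<close>). So the Green's
  operator is a sum of elementary operators all of whose points are evaluation points, and for such a
  sum the shape of the kernel can be read off: between two consecutive evaluation points no condition
  \<open>\<alpha> \<le> \<xi>\<close> changes its truth value, and the functional part depends only on the order of \<open>x\<close> and \<open>\<xi>\<close>
  (\<open>case_branches_kernel_of\<close>, \<open>outer_branches_kernel_of\<close>, \<open>dirac_combination_kernel_of\<close>).

  The assertion concerns every kernel that arises from some representation of the Green's operator,
  possibly with further points that cancel. Therefore the kernel must be shown to be determined by the
  operator (\<open>kernel_eq_kernel_of\<close>). Polynomials suffice as test functions here. Multiplied by a
  polynomial that vanishes to high order at the points of all Dirac distributions, they isolate the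
  functional part, which is then zero by the Weierstrass approximation theorem; products of powers of
  linear factors separate the Dirac distributions and their derivatives from each other.

  The existence of the fundamental system is proved by Picard iteration for linear systems
  (\<open>linear_system_solution\<close>); the functions \<open>v\<^sub>j\<close> come from solving the adjoint system as well
  (\<open>fundamental_matrix\<close>).
\<close>

section \<open>Smooth functions\<close>

text \<open>
  Smoothness is a property of all derivatives at once, which gives no induction for a product: the
  derivative of \<open>u v\<close> involves \<open>u\<close> and \<open>v\<close> again. Differentiability up to a finite order can be
  proved by induction on the order, because the factors may lose one order at each step.
\<close>

fun differentiable_upto :: "nat \<Rightarrow> (real \<Rightarrow> 'k::real_normed_vector) \<Rightarrow> bool" where
  "differentiable_upto 0 u \<longleftrightarrow> (\<forall>x. u differentiable at x)"
| "differentiable_upto (Suc i) u \<longleftrightarrow> (\<forall>x. u differentiable at x) \<and> differentiable_upto i (ddx u)"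

lemma differentiable_upto_iff:
  "differentiable_upto i u \<longleftrightarrow> (\<forall>j\<le>i. \<forall>x. (ddx ^^ j) u differentiable at x)"
proof (induction i arbitrary: u)
  case (Suc i)
  have "(\<forall>j\<le>Suc i. \<forall>x. (ddx ^^ j) u differentiable at x) \<longleftrightarrow>
     (\<forall>x. u differentiable at x) \<and> (\<forall>j\<le>i. \<forall>x. (ddx ^^ j) (ddx u) differentiable at x)"
    by (simp only: less_Suc_eq_le[symmetric] All_less_Suc2 funpow_Suc_right o_apply funpow_0)
  then show ?case using Suc by simp
qed simp

lemma differentiable_upto_Suc_D: "differentiable_upto (Suc i) u \<Longrightarrow> differentiable_upto i u"
  by (auto simp: differentiable_upto_iff)

lemma smooth_iff_differentiable_upto: "smooth u \<longleftrightarrow> (\<forall>i. differentiable_upto i u)"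
  by (auto simp: smooth_def differentiable_upto_iff)

lemma smooth_iff_ddx: "smooth u \<longleftrightarrow> (\<forall>x. u differentiable at x) \<and> smooth (ddx u)"
proof -
  have "(\<forall>i. differentiable_upto i u) \<longleftrightarrow> (\<forall>i. differentiable_upto (Suc i) u)"
    using differentiable_upto_Suc_D by iprover
  then show ?thesis by (simp add: smooth_iff_differentiable_upto)
qed

lemma smooth_ddx: "smooth u \<Longrightarrow> smooth (ddx u)"
  using smooth_iff_ddx by blast

lemma smooth_ddx_funpow: "smooth u \<Longrightarrow> smooth ((ddx ^^ i) u)"
  by (induction i) (auto intro: smooth_ddx)

lemma ddx_eqI: "(\<And>x. (u has_vector_derivative u' x) (at x)) \<Longrightarrow> ddx u = u'"
  by (auto simp: ddx_def vector_derivative_at)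

lemma smooth_has_vector_derivative: "smooth u \<Longrightarrow> (u has_vector_derivative ddx u x) (at x)"
  using smooth_iff_ddx[of u] by (simp add: ddx_def vector_derivative_works)

lemma smooth_continuous_on: "smooth u \<Longrightarrow> continuous_on S u"
  by (rule continuous_at_imp_continuous_on)
     (auto intro: has_vector_derivative_continuous[OF smooth_has_vector_derivative])

lemma smoothI_ddx:
  assumes "\<And>x. (u has_vector_derivative u' x) (at x)" "smooth u'"
  shows "smooth u"
  using assms smooth_iff_ddx[of u] ddx_eqI[of u u'] by (metis differentiableI_vector)

lemma differentiable_uptoI_ddx:
  assumes "\<And>x. (u has_vector_derivative u' x) (at x)" "differentiable_upto i u'"
  shows "differentiable_upto (Suc i) u"
  using assms ddx_eqI[of u u'] by (metis differentiable_upto.simps(2) differentiableI_vector)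

lemma differentiable_upto_has_vector_derivative:
  "differentiable_upto i u \<Longrightarrow> (u has_vector_derivative ddx u x) (at x)"
  by (cases i) (auto simp: ddx_def vector_derivative_works)

lemma ddx_const: "ddx (\<lambda>x. c) = (\<lambda>x. 0)"
  by (rule ddx_eqI) simp

lemma smooth_const: "smooth (\<lambda>x. c)"
proof -
  have "(ddx ^^ i) (\<lambda>x. c) = (if i = 0 then \<lambda>x. c else (\<lambda>x. 0))" for i
    by (induction i) (auto simp: ddx_const)
  then show ?thesis by (simp add: smooth_def)
qed

lemma differentiable_upto_add:
  "differentiable_upto i u \<Longrightarrow> differentiable_upto i v \<Longrightarrow> differentiable_upto i (\<lambda>x. u x + v x)"
proof (induction i arbitrary: u v)
  case (Suc i)
  show ?case
  proof (rule differentiable_uptoI_ddx[where u'="\<lambda>x. ddx u x + ddx v x"])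
    show "((\<lambda>x. u x + v x) has_vector_derivative ddx u x + ddx v x) (at x)" for x
      by (intro has_vector_derivative_add
            differentiable_upto_has_vector_derivative[OF Suc.prems(1)]
            differentiable_upto_has_vector_derivative[OF Suc.prems(2)])
    show "differentiable_upto i (\<lambda>x. ddx u x + ddx v x)"
      by (rule Suc.IH) (use Suc.prems in simp_all)
  qed
qed auto

lemma differentiable_upto_mult:
  fixes u v :: "real \<Rightarrow> 'k::real_normed_algebra"
  shows "differentiable_upto i u \<Longrightarrow> differentiable_upto i v \<Longrightarrow> differentiable_upto i (\<lambda>x. u x * v x)"
proof (induction i arbitrary: u v)
  case (Suc i)
  show ?case
  proof (rule differentiable_uptoI_ddx[where u'="\<lambda>x. u x * ddx v x + ddx u x * v x"])
    show "((\<lambda>x. u x * v x) has_vector_derivative u x * ddx v x + ddx u x * v x) (at x)" for x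
      by (intro has_vector_derivative_mult differentiable_upto_has_vector_derivative[OF Suc.prems(1)]
            differentiable_upto_has_vector_derivative[OF Suc.prems(2)])
    show "differentiable_upto i (\<lambda>x. u x * ddx v x + ddx u x * v x)"
      by (intro differentiable_upto_add Suc.IH differentiable_upto_Suc_D[OF Suc.prems(1)]
            differentiable_upto_Suc_D[OF Suc.prems(2)]) (use Suc.prems in simp_all)
  qed
qed auto

lemma smooth_add: "smooth u \<Longrightarrow> smooth v \<Longrightarrow> smooth (\<lambda>x. u x + v x)"
  by (simp add: smooth_iff_differentiable_upto differentiable_upto_add)

lemma smooth_mult:
  fixes u v :: "real \<Rightarrow> 'k::real_normed_algebra"
  shows "smooth u \<Longrightarrow> smooth v \<Longrightarrow> smooth (\<lambda>x. u x * v x)"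
  by (simp add: smooth_iff_differentiable_upto differentiable_upto_mult)

lemma smooth_minus:
  fixes u :: "real \<Rightarrow> 'k::real_normed_algebra_1"
  shows "smooth u \<Longrightarrow> smooth (\<lambda>x. - u x)"
  using smooth_mult[OF smooth_const[of "-1"], of u] by simp

lemma smooth_diff:
  fixes u :: "real \<Rightarrow> 'k::real_normed_algebra_1"
  shows "smooth u \<Longrightarrow> smooth v \<Longrightarrow> smooth (\<lambda>x. u x - v x)"
  using smooth_add[OF _ smooth_minus, of u v] by simp

lemma smooth_sum: "(\<And>i. i \<in> I \<Longrightarrow> smooth (u i)) \<Longrightarrow> smooth (\<lambda>x. \<Sum>i\<in>I. u i x)"
  by (induction I rule: infinite_finite_induct) (auto intro: smooth_const smooth_add)

lemma smooth_sum_list: "(\<And>i. i \<in> set I \<Longrightarrow> smooth (u i)) \<Longrightarrow> smooth (\<lambda>x. \<Sum>i\<leftarrow>I. u i x)"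
  by (induction I) (auto intro: smooth_const smooth_add)

lemma smooth_prod:
  fixes u :: "'i \<Rightarrow> real \<Rightarrow> 'k::real_normed_field"
  shows "(\<And>i. i \<in> I \<Longrightarrow> smooth (u i)) \<Longrightarrow> smooth (\<lambda>x. \<Prod>i\<in>I. u i x)"
  by (induction I rule: infinite_finite_induct) (auto intro: smooth_const smooth_mult)

lemma smooth_power:
  fixes u :: "real \<Rightarrow> 'k::real_normed_field"
  shows "smooth u \<Longrightarrow> smooth (\<lambda>x. u x ^ m)"
  by (induction m) (auto intro: smooth_const smooth_mult)

lemma smooth_of_real: "smooth (\<lambda>x. of_real x :: 'k::real_normed_field)"
  by (rule smoothI_ddx[where u'="\<lambda>x. 1"])
     (auto intro!: smooth_const has_vector_derivative_of_real derivative_eq_intros)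

lemmas smooth_intros = smooth_const smooth_add smooth_mult smooth_minus smooth_diff smooth_sum
  smooth_sum_list smooth_prod smooth_power smooth_of_real smooth_ddx smooth_ddx_funpow

lemma ddx_add: "smooth u \<Longrightarrow> smooth v \<Longrightarrow> ddx (\<lambda>x. u x + v x) = (\<lambda>x. ddx u x + ddx v x)"
  by (intro ddx_eqI has_vector_derivative_add smooth_has_vector_derivative)

lemma ddx_mult:
  fixes u v :: "real \<Rightarrow> 'k::real_normed_algebra"
  shows "smooth u \<Longrightarrow> smooth v \<Longrightarrow> ddx (\<lambda>x. u x * v x) = (\<lambda>x. u x * ddx v x + ddx u x * v x)"
  by (intro ddx_eqI has_vector_derivative_mult smooth_has_vector_derivative)

lemma ddx_funpow_add:
  "smooth u \<Longrightarrow> smooth v \<Longrightarrow> (ddx ^^ i) (\<lambda>x. u x + v x) = (\<lambda>x. (ddx ^^ i) u x + (ddx ^^ i) v x)"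
  by (induction i) (auto simp: ddx_add smooth_ddx_funpow)

lemma ddx_funpow_zero: "(ddx ^^ i) (\<lambda>x. 0) = (\<lambda>x. 0)"
  by (induction i) (auto simp: ddx_const)

lemma ddx_funpow_cmult:
  fixes u :: "real \<Rightarrow> 'k::real_normed_algebra"
  shows "smooth u \<Longrightarrow> (ddx ^^ i) (\<lambda>x. c * u x) = (\<lambda>x. c * (ddx ^^ i) u x)"
  by (induction i) (auto simp: ddx_mult ddx_const smooth_const smooth_ddx_funpow)

lemma ddx_funpow_sum:
  "(\<And>j. j \<in> I \<Longrightarrow> smooth (u j)) \<Longrightarrow>
    (ddx ^^ i) (\<lambda>x. \<Sum>j\<in>I. u j x) = (\<lambda>x. \<Sum>j\<in>I. (ddx ^^ i) (u j) x)"
  by (induction I rule: infinite_finite_induct) (auto simp: ddx_funpow_zero ddx_funpow_add smooth_sum)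

section \<open>Integrals with a variable end point\<close>

abbreviation integral_from :: "real \<Rightarrow> (real \<Rightarrow> 'k::{real_normed_field,euclidean_space}) \<Rightarrow> real \<Rightarrow> 'k"
  where "integral_from a f x \<equiv> (LBINT \<xi>=ereal a..ereal x. f \<xi>)"

lemma integral_from_eq_diff:
  fixes F f :: "real \<Rightarrow> 'k::{real_normed_field,euclidean_space}"
  assumes "\<And>x. (F has_vector_derivative f x) (at x)" "continuous_on UNIV f"
  shows "integral_from a f b = F b - F a"
  by (rule interval_integral_FTC_finite)
     (use assms in \<open>auto intro: continuous_on_subset has_vector_derivative_at_within\<close>)

lemma has_vector_derivative_integral_from:
  fixes f :: "real \<Rightarrow> 'k::{real_normed_field,euclidean_space}"
  assumes "continuous_on UNIV f"
  shows "(integral_from a f has_vector_derivative f x) (at x)"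
proof -
  have "(integral_from a f has_vector_derivative f x) (at x within {min a x - 1..max a x + 1})"
    by (rule interval_integral_FTC2) (use assms in \<open>auto intro: continuous_on_subset\<close>)
  then show ?thesis
    by (subst (asm) at_within_Icc_at) auto
qed

lemma ddx_integral_from:
  fixes f :: "real \<Rightarrow> 'k::{real_normed_field,euclidean_space}"
  shows "smooth f \<Longrightarrow> ddx (integral_from a f) = f"
  by (intro ddx_eqI has_vector_derivative_integral_from smooth_continuous_on)

lemma smooth_integral_from:
  fixes f :: "real \<Rightarrow> 'k::{real_normed_field,euclidean_space}"
  shows "smooth f \<Longrightarrow> smooth (integral_from a f)"
  by (rule smoothI_ddx[OF has_vector_derivative_integral_from]) (auto intro: smooth_continuous_on)

lemma continuous_integral_from:
  fixes f :: "real \<Rightarrow> 'k::{real_normed_field,euclidean_space}"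
  shows "continuous_on UNIV f \<Longrightarrow> continuous_on S (integral_from a f)"
  by (rule continuous_at_imp_continuous_on)
     (auto intro: has_vector_derivative_continuous[OF has_vector_derivative_integral_from])

text \<open>
  One integration gains a factor \<open>\<bar>x - a\<bar> / (k + 1)\<close>, on either side of \<open>a\<close>. Iterated, this is what
  makes the Picard series below converge like an exponential series.
\<close>

lemma integral_from_norm_le:
  fixes f :: "real \<Rightarrow> 'k::{real_normed_field,euclidean_space}"
  assumes "continuous_on UNIV f" and bnd: "\<And>t. \<bar>t - a\<bar> \<le> \<bar>x - a\<bar> \<Longrightarrow> norm (f t) \<le> C * \<bar>t - a\<bar> ^ k"
  shows "norm (integral_from a f x) \<le> C * \<bar>x - a\<bar> ^ Suc k / real (Suc k)"
proof -
  let ?F = "integral_from a f"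
  note der = has_vector_derivative_integral_from[OF assms(1), of a]
  have zero: "?F a = 0" by simp
  consider "x = a" | "a < x" | "x < a" by linarith
  then show ?thesis
  proof cases
    case 2
    have "norm (?F x - ?F a) \<le> C * (x - a) ^ Suc k / real (Suc k) - C * (a - a) ^ Suc k / real (Suc k)"
    proof (rule differentiable_bound_general[OF 2, where \<phi>="\<lambda>t. C * (t - a) ^ Suc k / real (Suc k)"])
      show "(?F has_vector_derivative f t) (at t)" for t by (rule der)
      show "((\<lambda>t. C * (t - a) ^ Suc k / real (Suc k)) has_vector_derivative C * (t - a) ^ k) (at t)" for t
        unfolding has_real_derivative_iff_has_vector_derivative[symmetric]
        by (rule derivative_eq_intros refl | simp del: of_nat_Suc)+
      show "norm (f t) \<le> C * (t - a) ^ k" if "a < t" "t < x" for t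
        using bnd[of t] that by simp
    qed (use assms(1) in \<open>auto intro!: continuous_integral_from continuous_intros\<close>)
    then show ?thesis using 2 zero by simp
  next
    case 3
    have "norm (?F a - ?F x) \<le> - (C * (a - a) ^ Suc k / real (Suc k)) - - (C * (a - x) ^ Suc k / real (Suc k))"
    proof (rule differentiable_bound_general[OF 3, where \<phi>="\<lambda>t. - (C * (a - t) ^ Suc k / real (Suc k))"])
      show "(?F has_vector_derivative f t) (at t)" for t by (rule der)
      show "((\<lambda>t. - (C * (a - t) ^ Suc k / real (Suc k))) has_vector_derivative C * (a - t) ^ k) (at t)" for t
        unfolding has_real_derivative_iff_has_vector_derivative[symmetric]
        by (rule derivative_eq_intros refl | simp del: of_nat_Suc)+
      show "norm (f t) \<le> C * (a - t) ^ k" if "x < t" "t < a" for t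
        using bnd[of t] that by simp
    qed (use assms(1) in \<open>auto intro!: continuous_integral_from continuous_intros\<close>)
    then show ?thesis using 3 zero by (simp del: power_Suc)
  qed simp
qed

section \<open>Linear systems of differential equations\<close>

text \<open>
  Termwise differentiation of a series of vector-valued functions of a real variable: the majorant
  makes the series of derivatives converge uniformly.
\<close>

lemma has_vector_derivative_suminf:
  fixes f :: "nat \<Rightarrow> real \<Rightarrow> 'k::banach"
  assumes S: "open S" "convex S" "x \<in> S"
    and der: "\<And>k t. t \<in> S \<Longrightarrow> (f k has_vector_derivative d k t) (at t)"
    and bound: "\<And>k t. t \<in> S \<Longrightarrow> norm (d k t) \<le> M k" and "summable M"
    and "summable (\<lambda>k. f k x)"
  shows "((\<lambda>t. \<Sum>k. f k t) has_vector_derivative (\<Sum>k. d k x)) (at x)"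
proof -
  have "uniform_limit S (\<lambda>m t. \<Sum>k<m. d k t) (\<lambda>t. \<Sum>k. d k t) sequentially"
    by (rule Weierstrass_m_test) (use bound \<open>summable M\<close> in auto)
  then have unif: "\<forall>\<^sub>F m in sequentially. \<forall>t\<in>S. norm ((\<Sum>k<m. d k t) - (\<Sum>k. d k t)) < e" if "e > 0" for e
    using that by (simp add: uniform_limit_iff dist_norm)
  have "\<exists>g. \<forall>t\<in>S. (\<lambda>k. f k t) sums g t \<and> (g has_derivative (\<lambda>h. h *\<^sub>R (\<Sum>k. d k t))) (at t within S)"
  proof (rule has_derivative_series[where f'="\<lambda>k t h. h *\<^sub>R d k t", OF \<open>convex S\<close> _ _ \<open>x \<in> S\<close>])
    show "(f k has_derivative (\<lambda>h. h *\<^sub>R d k t)) (at t within S)" if "t \<in> S" for k t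
      using der[OF that, of k] by (auto simp: has_vector_derivative_def intro: has_derivative_at_withinI)
    show "(\<lambda>k. f k x) sums (\<Sum>k. f k x)"
      using assms by (simp add: summable_sums)
    show "\<forall>\<^sub>F m in sequentially. \<forall>t\<in>S. \<forall>h. norm ((\<Sum>k<m. h *\<^sub>R d k t) - h *\<^sub>R (\<Sum>k. d k t)) \<le> e * norm h"
      if "e > 0" for e
      using unif[OF that]
    proof eventually_elim
      case (elim m)
      have "norm ((\<Sum>k<m. h *\<^sub>R d k t) - h *\<^sub>R (\<Sum>k. d k t)) \<le> e * norm h" if "t \<in> S" for t h
      proof -
        have "norm ((\<Sum>k<m. h *\<^sub>R d k t) - h *\<^sub>R (\<Sum>k. d k t)) = norm h * norm ((\<Sum>k<m. d k t) - (\<Sum>k. d k t))"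
          by (simp flip: norm_scaleR scaleR_sum_right scaleR_diff_right)
        also have "\<dots> \<le> norm h * e"
          using elim that by (intro mult_left_mono) (auto intro: less_imp_le)
        finally show ?thesis by (simp add: mult.commute)
      qed
      then show ?case by blast
    qed
  qed
  then obtain g where g: "\<forall>t\<in>S. (\<lambda>k. f k t) sums g t \<and>
      (g has_derivative (\<lambda>h. h *\<^sub>R (\<Sum>k. d k t))) (at t within S)" by (rule exE)
  have "(g has_vector_derivative (\<Sum>k. d k x)) (at x)"
    using conjunct2[OF bspec[OF g \<open>x \<in> S\<close>]]
    by (simp only: has_vector_derivative_def at_within_open[OF \<open>x \<in> S\<close> \<open>open S\<close>])
  then show ?thesis
    by (rule has_vector_derivative_transform_within_open[OF _ \<open>open S\<close> \<open>x \<in> S\<close>])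
       (use g in \<open>simp add: sums_unique\<close>)
qed

text \<open>
  These are the increments of the Picard iteration for \<open>y' = A y\<close>, \<open>y(a) = c\<close>, not the iterates; the
  solution is their sum.
\<close>

primrec picard :: "nat \<Rightarrow> (nat \<Rightarrow> nat \<Rightarrow> real \<Rightarrow> 'k::{real_normed_field,euclidean_space}) \<Rightarrow> real
    \<Rightarrow> (nat \<Rightarrow> 'k) \<Rightarrow> nat \<Rightarrow> nat \<Rightarrow> real \<Rightarrow> 'k" where
  "picard n A a c 0 = (\<lambda>i x. c i)"
| "picard n A a c (Suc k) = (\<lambda>i x. integral_from a (\<lambda>t. \<Sum>j<n. A i j t * picard n A a c k j t) x)"

text \<open>
  For \<open>\<bar>x - a\<bar> \<le> R\<close> the \<open>k\<close>-th increment is at most \<open>C (n M)\<^sup>k \<bar>x - a\<bar>\<^sup>k / k!\<close>, where \<open>M\<close> bounds the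
  entries of \<open>A\<close> on this interval. So the series and the series of the derivatives converge uniformly
  on every bounded interval, and the solution of a linear system exists on the whole line.
\<close>

lemma linear_system_solution:
  fixes A :: "nat \<Rightarrow> nat \<Rightarrow> real \<Rightarrow> 'k::{real_normed_field,euclidean_space}"
  assumes A: "\<And>i j. i < n \<Longrightarrow> j < n \<Longrightarrow> continuous_on UNIV (A i j)"
  obtains y where "\<And>i. i < n \<Longrightarrow> y i a = c i"
    "\<And>i x. i < n \<Longrightarrow> (y i has_vector_derivative (\<Sum>j<n. A i j x * y j x)) (at x)"
proof -
  define P where "P = picard n A a c"
  have P0: "P 0 i x = c i" for i x by (simp add: P_def)
  have PS: "P (Suc k) i = integral_from a (\<lambda>t. \<Sum>j<n. A i j t * P k j t)" for k i
    by (simp add: P_def fun_eq_iff)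
  have contP: "continuous_on UNIV (P k i)" if "i < n" for k i
    using that
  proof (induction k arbitrary: i)
    case (Suc k)
    then show ?case
      unfolding PS by (intro continuous_integral_from continuous_on_sum continuous_on_mult A) auto
  qed (simp add: P_def)
  \<comment> \<open>the derivatives of the increments: the first increment is constant, and each later one has the
      previous one in its derivative\<close>
  define D where "D k = (case k of 0 \<Rightarrow> (\<lambda>i x. 0) | Suc k \<Rightarrow> (\<lambda>i x. \<Sum>j<n. A i j x * P k j x))" for k
  have derP: "(P k i has_vector_derivative D k i x) (at x)" if "i < n" for k i x
  proof (cases k)
    case 0
    then show ?thesis by (simp add: P_def D_def)
  next
    case (Suc m)
    show ?thesis
      unfolding Suc D_def nat.case PS
      by (intro has_vector_derivative_integral_from continuous_on_sum continuous_on_mult A contP) (use that in auto)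
  qed
  have local: "\<exists>B M. summable B
      \<and> (\<forall>k i x. i < n \<longrightarrow> \<bar>x - a\<bar> \<le> R \<longrightarrow> norm (P k i x) \<le> B k)
      \<and> (\<forall>i j x. i < n \<longrightarrow> j < n \<longrightarrow> \<bar>x - a\<bar> \<le> R \<longrightarrow> norm (A i j x) \<le> M)" if "R > 0" for R
  proof -
    have "\<exists>M. \<forall>x\<in>{a - R..a + R}. norm (A i j x) \<le> M" if "i < n" "j < n" for i j
    proof -
      have "compact (A i j ` {a - R..a + R})"
        using A[OF that] by (intro compact_continuous_image) (auto intro: continuous_on_subset)
      then show ?thesis
        by (auto dest!: compact_imp_bounded simp: bounded_iff)
    qed
    then obtain M0 where M0: "\<And>i j x. i < n \<Longrightarrow> j < n \<Longrightarrow> x \<in> {a - R..a + R} \<Longrightarrow> norm (A i j x) \<le> M0 i j"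
      by metis
    define M where "M = (\<Sum>i<n. \<Sum>j<n. \<bar>M0 i j\<bar>)"
    have "M \<ge> 0" unfolding M_def by (intro sum_nonneg) auto
    have M: "norm (A i j x) \<le> M" if "i < n" "j < n" "\<bar>x - a\<bar> \<le> R" for i j x
    proof -
      have "norm (A i j x) \<le> \<bar>M0 i j\<bar>"
        using M0[of i j x] that by (auto simp: abs_le_iff)
      also have "\<dots> \<le> (\<Sum>j<n. \<bar>M0 i j\<bar>)"
        using that by (intro member_le_sum) auto
      also have "\<dots> \<le> M"
        unfolding M_def using that
        by (intro member_le_sum[of i _ "\<lambda>i. \<Sum>j<n. \<bar>M0 i j\<bar>"]) (auto intro: sum_nonneg)
      finally show ?thesis .
    qed
    define C where "C = (\<Sum>i<n. norm (c i))"
    have C: "norm (c i) \<le> C" if "i < n" for i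
      unfolding C_def using that by (intro member_le_sum) auto
    have "C \<ge> 0" unfolding C_def by (intro sum_nonneg) auto
    define L where "L = real n * M"
    have bnd: "norm (P k i x) \<le> C * L ^ k / fact k * \<bar>x - a\<bar> ^ k" if "i < n" "\<bar>x - a\<bar> \<le> R" for k i x
      using that
    proof (induction k arbitrary: i x)
      case 0
      then show ?case using C by (simp add: P0)
    next
      case (Suc k)
      have "norm (P (Suc k) i x) \<le> (C * L ^ Suc k / fact k) * \<bar>x - a\<bar> ^ Suc k / real (Suc k)"
        unfolding PS
      proof (rule integral_from_norm_le)
        show "continuous_on UNIV (\<lambda>t. \<Sum>j<n. A i j t * P k j t)"
          using Suc.prems by (intro continuous_on_sum continuous_on_mult A contP) auto
        show "norm (\<Sum>j<n. A i j t * P k j t) \<le> (C * L ^ Suc k / fact k) * \<bar>t - a\<bar> ^ k"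
          if "\<bar>t - a\<bar> \<le> \<bar>x - a\<bar>" for t
        proof -
          have "norm (\<Sum>j<n. A i j t * P k j t) \<le> (\<Sum>j<n. M * (C * L ^ k / fact k * \<bar>t - a\<bar> ^ k))"
          proof (rule sum_norm_le)
            fix j assume "j \<in> {..<n}"
            then show "norm (A i j t * P k j t) \<le> M * (C * L ^ k / fact k * \<bar>t - a\<bar> ^ k)"
              unfolding norm_mult using that Suc.prems \<open>M \<ge> 0\<close>
              by (intro mult_mono M Suc.IH) auto
          qed
          also have "\<dots> = (C * L ^ Suc k / fact k) * \<bar>t - a\<bar> ^ k"
            by (simp add: L_def)
          finally show ?thesis .
        qed
      qed
      also have "\<dots> = C * L ^ Suc k / fact (Suc k) * \<bar>x - a\<bar> ^ Suc k"
        by (simp add: mult.commute mult.left_commute)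
      finally show ?case .
    qed
    have "L \<ge> 0" using \<open>M \<ge> 0\<close> by (simp add: L_def)
    have "norm (P k i x) \<le> C * ((L * R) ^ k / fact k)" if "i < n" "\<bar>x - a\<bar> \<le> R" for k i x
    proof -
      have "norm (P k i x) \<le> C * L ^ k / fact k * \<bar>x - a\<bar> ^ k" by (rule bnd[OF that])
      also have "\<dots> \<le> C * L ^ k / fact k * R ^ k"
        using that \<open>C \<ge> 0\<close> \<open>L \<ge> 0\<close> by (intro mult_left_mono power_mono) auto
      finally show ?thesis by (simp add: power_mult_distrib)
    qed
    moreover have "summable (\<lambda>k. C * ((L * R) ^ k / fact k))"
      using summable_exp[of "L * R"] by (intro summable_mult) (simp add: field_simps)
    ultimately show ?thesis using M by blast
  qed
  have summP: "summable (\<lambda>k. P k i x)" if "i < n" for i x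
  proof -
    have pos: "0 < \<bar>x - a\<bar> + 1" by simp
    obtain B where B: "summable B"
        "\<forall>k i x'. i < n \<longrightarrow> \<bar>x' - a\<bar> \<le> \<bar>x - a\<bar> + 1 \<longrightarrow> norm (P k i x') \<le> B k"
      using local[OF pos] by - (elim exE conjE, rule that)
    have "norm (P k i x) \<le> B k" for k
      by (rule B(2)[rule_format]) (use that in auto)
    then show ?thesis by (rule summable_comparison_test'[OF \<open>summable B\<close>])
  qed
  define y where "y i x = (\<Sum>k. P k i x)" for i x
  show thesis
  proof
    show "y i a = c i" if "i < n" for i
    proof -
      have "P k i a = (if k = 0 then c i else 0)" for k
        by (cases k) (simp_all add: P0 PS)
      then have "(\<lambda>k. P k i a) = (\<lambda>k. if k = 0 then c i else 0)" by blast
      then show ?thesis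
        unfolding y_def using sums_single[of 0 "\<lambda>k. c i"] by (metis sums_unique)
    qed
    show "(y i has_vector_derivative (\<Sum>j<n. A i j x * y j x)) (at x)" if "i < n" for i x
    proof -
      define R where "R = \<bar>x - a\<bar> + 1"
      have "R > 0" by (simp add: R_def)
      obtain B M where B: "summable B"
          "\<forall>k i x. i < n \<longrightarrow> \<bar>x - a\<bar> \<le> R \<longrightarrow> norm (P k i x) \<le> B k"
        and M': "\<forall>i j x. i < n \<longrightarrow> j < n \<longrightarrow> \<bar>x - a\<bar> \<le> R \<longrightarrow> norm (A i j x) \<le> M"
        using local[OF \<open>R > 0\<close>] by - (elim exE conjE, rule that)
      note PB = B(2)[rule_format] and M = M'[rule_format]
      have "M \<ge> 0" using order_trans[OF norm_ge_zero M[OF that that, of a]] by (simp add: R_def)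
      define B' where "B' k = (case k of 0 \<Rightarrow> 0 | Suc k \<Rightarrow> real n * M * B k)" for k
      have "summable (\<lambda>k. B' (Suc k))"
        unfolding B'_def nat.case by (intro summable_mult \<open>summable B\<close>)
      then have "summable B'" by (simp add: summable_Suc_iff)
      have "(y i has_vector_derivative (\<Sum>k. D k i x)) (at x)"
        unfolding y_def
      proof (rule has_vector_derivative_suminf[where S="ball a R" and M=B'])
        show "norm (D k i t) \<le> B' k" if t: "t \<in> ball a R" for k t
        proof (cases k)
          case (Suc m)
          have t': "\<bar>t - a\<bar> \<le> R" using t by (simp add: dist_real_def)
          have "norm (\<Sum>j<n. A i j t * P m j t) \<le> (\<Sum>j<n. M * B m)"
          proof (rule sum_norm_le)
            fix j assume "j \<in> {..<n}"
            then show "norm (A i j t * P m j t) \<le> M * B m"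
              unfolding norm_mult using t' \<open>i < n\<close> \<open>M \<ge> 0\<close> by (intro mult_mono M PB) auto
          qed
          then show ?thesis by (simp add: Suc D_def B'_def)
        qed (simp add: D_def B'_def)
      qed (use that \<open>summable B'\<close> in \<open>auto simp: R_def dist_real_def summP derP\<close>)
      also have "(\<Sum>k. D k i x) = (\<Sum>k. D (Suc k) i x)"
      proof -
        have "summable (\<lambda>k. D (Suc k) i x)"
          unfolding D_def nat.case by (intro summable_sum summable_mult summP) auto
        then have "summable (\<lambda>k. D k i x)" using summable_Suc_iff[of "\<lambda>k. D k i x"] by blast
        moreover have "D 0 i x = 0" by (simp add: D_def)
        ultimately show ?thesis using suminf_split_head[of "\<lambda>k. D k i x"] by simp
      qed
      also have "\<dots> = (\<Sum>j<n. \<Sum>k. A i j x * P k j x)"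
        unfolding D_def nat.case by (intro suminf_sum summable_mult summP) auto
      also have "\<dots> = (\<Sum>j<n. A i j x * y j x)"
        unfolding y_def by (intro sum.cong refl suminf_mult summP) auto
      finally show ?thesis .
    qed
  qed
qed

text \<open>
  The equation expresses \<open>y'\<close> by \<open>y\<close> and smooth functions, so each order of differentiability of all
  the components yields the next.
\<close>

lemma linear_system_smooth:
  fixes A :: "nat \<Rightarrow> nat \<Rightarrow> real \<Rightarrow> 'k::real_normed_field"
  assumes A: "\<And>i j. i < n \<Longrightarrow> j < n \<Longrightarrow> smooth (A i j)"
    and y: "\<And>i x. i < n \<Longrightarrow> (y i has_vector_derivative (\<Sum>j<n. A i j x * y j x)) (at x)"
    and "i < n"
  shows "smooth (y i)"
proof -
  have sum: "differentiable_upto k (\<lambda>x. \<Sum>j\<in>J. u j x)"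
    if "finite J" "\<And>j. j \<in> J \<Longrightarrow> differentiable_upto k (u j)" for k J and u :: "nat \<Rightarrow> real \<Rightarrow> 'k"
    using that
  proof (induction J rule: finite_induct)
    case empty
    then show ?case using smooth_const[of "0::'k"] by (simp add: smooth_iff_differentiable_upto)
  qed (auto intro: differentiable_upto_add)
  have "differentiable_upto k (y i)" if "i < n" for k i
    using that
  proof (induction k arbitrary: i)
    case 0
    then show ?case using y by (auto intro: differentiableI_vector)
  next
    case (Suc k)
    show ?case
      by (rule differentiable_uptoI_ddx[OF y[OF Suc.prems]])
         (use A Suc in \<open>auto intro!: sum differentiable_upto_mult simp: smooth_iff_differentiable_upto\<close>)
  qed
  then show ?thesis using \<open>i < n\<close> by (simp add: smooth_iff_differentiable_upto)
qed

section \<open>Square matrices\<close>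

text \<open>
  Both facts on square matrices are needed for arrays indexed by natural numbers, since the order of
  the differential equation is a variable; they are transported from matrices of variable size.
\<close>

lemma left_inverse_imp_right_inverse:
  fixes Z Y :: "nat \<Rightarrow> nat \<Rightarrow> 'k::field"
  assumes "\<And>i l. i < n \<Longrightarrow> l < n \<Longrightarrow> (\<Sum>j<n. Z i j * Y j l) = of_bool (i = l)"
    and "i < n" "l < n"
  shows "(\<Sum>j<n. Y i j * Z j l) = of_bool (i = l)"
proof -
  let ?Z = "Matrix.mat n n (\<lambda>(i, j). Z i j)" and ?Y = "Matrix.mat n n (\<lambda>(i, j). Y i j)"
  have "?Z * ?Y = 1\<^sub>m n"
    by (rule eq_matI) (use assms(1) in \<open>auto simp: scalar_prod_def lessThan_atLeast0\<close>)
  then have "?Y * ?Z = 1\<^sub>m n"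
    by (intro mat_mult_left_right_inverse[of ?Z n ?Y]) auto
  then have "(?Y * ?Z) $$ (i, l) = of_bool (i = l)" using assms by simp
  then show ?thesis using assms(2,3) by (simp add: scalar_prod_def lessThan_atLeast0)
qed

lemma injective_imp_right_inverse:
  fixes M :: "nat \<Rightarrow> nat \<Rightarrow> 'k::field"
  assumes inj: "\<And>a. (\<And>i. i < n \<Longrightarrow> (\<Sum>j<n. M i j * a j) = 0) \<Longrightarrow> \<forall>j<n. a j = 0"
  obtains N where "\<And>i l. i < n \<Longrightarrow> l < n \<Longrightarrow> (\<Sum>j<n. M i j * N j l) = of_bool (i = l)"
proof -
  let ?M = "Matrix.mat n n (\<lambda>(i, j). M i j)"
  have "Determinant.det ?M \<noteq> 0"
  proof
    assume "Determinant.det ?M = 0"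
    then obtain v where v: "v \<in> carrier_vec n" "v \<noteq> 0\<^sub>v n" "?M *\<^sub>v v = 0\<^sub>v n"
      using det_0_iff_vec_prod_zero_field[of ?M n] by auto
    have "(\<Sum>j<n. M i j * v $ j) = 0" if "i < n" for i
    proof -
      have "(?M *\<^sub>v v) $ i = 0" using v(3) that by simp
      then show ?thesis using that v(1) by (simp add: scalar_prod_def lessThan_atLeast0)
    qed
    then have "\<forall>j<n. v $ j = 0" using inj[of "\<lambda>j. v $ j"] by blast
    then have "v = 0\<^sub>v n" using v(1) by (intro eq_vecI) auto
    then show False using v(2) by simp
  qed
  then obtain B where B: "B \<in> carrier_mat n n" "?M * B = 1\<^sub>m n"
    using det_non_zero_imp_unit[of ?M n "()"] by (auto simp: Units_def ring_mat_def)
  show thesis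
  proof (rule that[of "\<lambda>i j. B $$ (i, j)"])
    fix i l assume il: "i < n" "l < n"
    have "(?M * B) $$ (i, l) = of_bool (i = l)" using il B(2) by simp
    then show "(\<Sum>j<n. M i j * B $$ (j, l)) = of_bool (i = l)"
      using il B(1) by (simp add: scalar_prod_def lessThan_atLeast0)
  qed
qed

section \<open>Variation of constants\<close>

lemma zero_derivative_imp_const:
  fixes h :: "real \<Rightarrow> 'k::real_normed_vector"
  assumes "\<And>x. (h has_vector_derivative 0) (at x)"
  shows "h x = h a"
proof -
  obtain c where "\<And>x. h x = c"
    using has_vector_derivative_zero_constant[of UNIV h] assms
    by auto
  then show ?thesis by simp
qed

text \<open>
  The rows of \<open>Z\<close> solve the adjoint system \<open>z' = - z A\<close>, so \<open>(Z Y)' = - Z A Y + Z A Y = 0\<close>, and \<open>Z Y\<close>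
  stays the identity matrix that it is at \<open>0\<close>. In this way the inverse of the fundamental matrix \<open>Y\<close>
  is obtained as a smooth function, and no Wronskian determinant has to be divided by.
\<close>

lemma fundamental_matrix:
  fixes A :: "nat \<Rightarrow> nat \<Rightarrow> real \<Rightarrow> 'k::{real_normed_field,euclidean_space}"
  assumes A: "\<And>i j. i < n \<Longrightarrow> j < n \<Longrightarrow> smooth (A i j)"
  obtains Y Z where
    "\<And>i j. i < n \<Longrightarrow> j < n \<Longrightarrow> smooth (Y i j)"
    "\<And>i j. i < n \<Longrightarrow> j < n \<Longrightarrow> smooth (Z i j)"
    "\<And>i j x. i < n \<Longrightarrow> j < n \<Longrightarrow> (Y i j has_vector_derivative (\<Sum>k<n. A i k x * Y k j x)) (at x)"
    "\<And>i j x. i < n \<Longrightarrow> j < n \<Longrightarrow> (\<Sum>k<n. Y i k x * Z k j x) = of_bool (i = j)"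
    "\<And>i j x. i < n \<Longrightarrow> j < n \<Longrightarrow> (\<Sum>k<n. Z i k x * Y k j x) = of_bool (i = j)"
proof -
  have sol: "\<exists>y. \<forall>i<n. y i 0 = of_bool (i = j) \<and>
      (\<forall>x. (y i has_vector_derivative (\<Sum>k<n. B i k x * y k x)) (at x))"
    if B: "\<And>i k. i < n \<Longrightarrow> k < n \<Longrightarrow> smooth (B i k)"
    for B :: "nat \<Rightarrow> nat \<Rightarrow> real \<Rightarrow> 'k" and j
  proof (rule linear_system_solution[of n B 0 "\<lambda>i. of_bool (i = j)"])
    show "continuous_on UNIV (B i k)" if "i < n" "k < n" for i k
      using B[OF that] by (rule smooth_continuous_on)
  next
    fix y :: "nat \<Rightarrow> real \<Rightarrow> 'k"
    assume "\<And>i. i < n \<Longrightarrow> y i 0 = of_bool (i = j)"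
      "\<And>i x. i < n \<Longrightarrow> (y i has_vector_derivative (\<Sum>k<n. B i k x * y k x)) (at x)"
    then show ?thesis by (intro exI[of _ y]) simp
  qed
  have A': "smooth (\<lambda>x. - A k i x)" if "i < n" "k < n" for i k
    using that by (intro smooth_minus A)
  obtain Y' where Y': "\<forall>j. \<forall>i<n. Y' j i 0 = of_bool (i = j) \<and>
      (\<forall>x. (Y' j i has_vector_derivative (\<Sum>k<n. A i k x * Y' j k x)) (at x))"
    using choice[OF allI[OF sol[of A, OF A]]] by (rule exE)
  obtain Z where Z': "\<forall>j. \<forall>i<n. Z j i 0 = of_bool (i = j) \<and>
      (\<forall>x. (Z j i has_vector_derivative (\<Sum>k<n. - A k i x * Z j k x)) (at x))"
    using choice[OF allI[OF sol[of "\<lambda>i k x. - A k i x", OF A']]] by (rule exE)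
  have Z: "Z j i 0 = of_bool (i = j)"
    "(Z j i has_vector_derivative (\<Sum>k<n. - A k i x * Z j k x)) (at x)" if "i < n" for i j x
    using Z' that by blast+
  define Y where "Y i j = Y' j i" for i j
  have Y: "Y i j 0 = of_bool (i = j)"
    "(Y i j has_vector_derivative (\<Sum>k<n. A i k x * Y k j x)) (at x)" if "i < n" for i j x
    unfolding Y_def using Y' that by blast+
  have ZY: "(\<Sum>k<n. Z i k x * Y k j x) = of_bool (i = j)" if "i < n" "j < n" for i j x
  proof -
    have "(\<Sum>k<n. Z i k x * Y k j x) = (\<Sum>k<n. Z i k 0 * Y k j 0)"
    proof (rule zero_derivative_imp_const[where h="\<lambda>x. \<Sum>k<n. Z i k x * Y k j x"])
      fix x
      have "((\<lambda>x. \<Sum>k<n. Z i k x * Y k j x) has_vector_derivative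
          (\<Sum>k<n. Z i k x * (\<Sum>l<n. A k l x * Y l j x) + (\<Sum>l<n. - A l k x * Z i l x) * Y k j x)) (at x)"
        by (intro has_vector_derivative_sum has_vector_derivative_mult Z(2) Y(2)) (use that in auto)
      also have "(\<Sum>k<n. Z i k x * (\<Sum>l<n. A k l x * Y l j x) + (\<Sum>l<n. - A l k x * Z i l x) * Y k j x) =
          (\<Sum>k<n. \<Sum>l<n. Z i k x * A k l x * Y l j x) - (\<Sum>k<n. \<Sum>l<n. Z i l x * A l k x * Y k j x)"
        by (simp add: sum.distrib sum_distrib_left sum_distrib_right sum_negf sum_subtractf mult_ac)
      also have "\<dots> = 0" by (subst (2) sum.swap) simp
      finally show "((\<lambda>x. \<Sum>k<n. Z i k x * Y k j x) has_vector_derivative 0) (at x)" .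
    qed
    also have "\<dots> = (\<Sum>k<n. if k = i then of_bool (i = j) else 0)"
      by (intro sum.cong refl) (use that in \<open>auto simp: Z(1) Y(1)\<close>)
    also have "\<dots> = of_bool (i = j)" using that by simp
    finally show ?thesis .
  qed
  show thesis
  proof (rule that[of Y Z])
    show "smooth (Y i j)" if "i < n" "j < n" for i j
      by (rule linear_system_smooth[where A=A and y="\<lambda>i. Y i j", OF A _ \<open>i < n\<close>])
         (assumption | rule Y(2))+
    show "smooth (Z i j)" if "i < n" "j < n" for i j
      by (rule linear_system_smooth[where A="\<lambda>i k x. - A k i x" and y="Z i", OF A' _ \<open>j < n\<close>])
         (assumption | rule Z(2))+
    show "(\<Sum>k<n. Y i k x * Z k j x) = of_bool (i = j)" if "i < n" "j < n" for i j x
      by (rule left_inverse_imp_right_inverse[where n=n and Z="\<lambda>i j. Z i j x" and Y="\<lambda>i j. Y i j x"])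
         (use ZY that in auto)
    show "(Y i j has_vector_derivative (\<Sum>k<n. A i k x * Y k j x)) (at x)" if "i < n" "j < n" for i j x
      using \<open>i < n\<close> by (rule Y(2))
    show "(\<Sum>k<n. Z i k x * Y k j x) = of_bool (i = j)" if "i < n" "j < n" for i j x
      using that by (rule ZY)
  qed
qed

text \<open>
  The matrix of the first-order system for \<open>(u, u', \<dots>, u\<^bsup>(n-1)\<^esup>)\<close>. All rows but the last one say that
  each component is the derivative of the previous one.
\<close>

definition companion_matrix ::
  "(real \<Rightarrow> 'k::{real_normed_field,euclidean_space}) list \<Rightarrow> nat \<Rightarrow> nat \<Rightarrow> real \<Rightarrow> 'k" where
  "companion_matrix cs i k x =
     (if Suc i = length cs then - (cs ! k) x else of_bool (k = Suc i))"

lemma smooth_companion_matrix: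
  assumes "\<forall>c\<in>set cs. smooth c" "k < length cs"
  shows "smooth (companion_matrix cs i k)"
proof -
  have "companion_matrix cs i k =
      (if Suc i = length cs then \<lambda>x. - (cs ! k) x else (\<lambda>x. of_bool (k = Suc i)))"
    by (auto simp: companion_matrix_def fun_eq_iff)
  then show ?thesis using assms by (auto intro: smooth_minus smooth_const)
qed

text \<open>
  The inhomogeneity \<open>f\<close> enters in the last row only. The case \<open>f = 0\<close> describes the columns of a
  fundamental matrix, the general case the particular solution found by variation of constants.
\<close>

lemma companion_system_solution:
  fixes y :: "nat \<Rightarrow> real \<Rightarrow> 'k::{real_normed_field,euclidean_space}"
  assumes n: "n = length cs" "0 < n"
    and y: "\<And>i x. i < n \<Longrightarrow> (y i has_vector_derivative
      (\<Sum>k<n. companion_matrix cs i k x * y k x) + of_bool (Suc i = n) * f x) (at x)"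
  shows "i < n \<Longrightarrow> (ddx ^^ i) (y 0) = y i" and "diff_op cs (y 0) = f"
proof -
  have low: "ddx (y i) = y (Suc i)" if "Suc i < n" for i
    using y[of i] that n by (intro ddx_eqI) (auto simp: companion_matrix_def)
  have ddx_y: "(ddx ^^ i) (y 0) = y i" if "i < n" for i
    using that by (induction i) (auto simp: low)
  then show "i < n \<Longrightarrow> (ddx ^^ i) (y 0) = y i" .
  obtain m where m: "n = Suc m" using n(2) by (cases n) auto
  have "ddx (y m) = (\<lambda>x. (\<Sum>k<n. - (cs ! k) x * y k x) + f x)"
    using y[of m] m n by (intro ddx_eqI) (auto simp: companion_matrix_def)
  then have top: "(ddx ^^ n) (y 0) = (\<lambda>x. (\<Sum>k<n. - (cs ! k) x * y k x) + f x)"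
    using ddx_y[of m] by (simp add: m)
  have "(\<Sum>k<n. (cs ! k) x * (ddx ^^ k) (y 0) x) = (\<Sum>k<n. (cs ! k) x * y k x)" for x
    by (intro sum.cong) (auto simp: ddx_y)
  then show "diff_op cs (y 0) = f"
    by (simp add: diff_op_def n(1)[symmetric] top sum_negf fun_eq_iff)
qed

lemma diff_op_add:
  "smooth u \<Longrightarrow> smooth v \<Longrightarrow> diff_op cs (\<lambda>x. u x + v x) = (\<lambda>x. diff_op cs u x + diff_op cs v x)"
  by (simp add: diff_op_def ddx_funpow_add algebra_simps sum.distrib)

lemma diff_op_cmult:
  "smooth u \<Longrightarrow> diff_op cs (\<lambda>x. c * u x) = (\<lambda>x. c * diff_op cs u x)"
  by (simp add: diff_op_def ddx_funpow_cmult algebra_simps sum_distrib_left)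

lemma diff_op_zero: "diff_op cs (\<lambda>x. 0) = (\<lambda>x. 0)"
  by (simp add: diff_op_def ddx_funpow_zero)

lemma diff_op_sum:
  "(\<And>j. j \<in> I \<Longrightarrow> smooth (u j)) \<Longrightarrow>
    diff_op cs (\<lambda>x. \<Sum>j\<in>I. u j x) = (\<lambda>x. \<Sum>j\<in>I. diff_op cs (u j) x)"
  by (induction I rule: infinite_finite_induct) (auto simp: diff_op_zero diff_op_add smooth_sum)

text \<open>
  With a fundamental matrix \<open>Y\<close> and its inverse \<open>Z\<close>, the vector \<open>Y(x) \<integral>\<^sub>a\<^sup>x Z b f\<close>, \<open>b\<close> being the last unit
  vector, solves the inhomogeneous system because \<open>Y Z b = b\<close>. Its first component has the form below,
  where \<open>u\<close> is the first row of \<open>Y\<close> and \<open>v\<close> the last column of \<open>Z\<close>. The base point \<open>a\<close> is free; it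
  will be an evaluation point of the boundary problem.
\<close>

lemma variation_of_constants:
  fixes cs :: "(real \<Rightarrow> 'k::{real_normed_field,euclidean_space}) list"
  assumes n: "n = length cs" "0 < n" and cs: "\<forall>c\<in>set cs. smooth c"
  obtains u v :: "nat \<Rightarrow> real \<Rightarrow> 'k" where
    "\<And>j. j < n \<Longrightarrow> smooth (u j)" "\<And>j. j < n \<Longrightarrow> smooth (v j)"
    "\<And>j. j < n \<Longrightarrow> diff_op cs (u j) = (\<lambda>x. 0)"
    "\<And>c. (\<lambda>x. \<Sum>j<n. c j * u j x) = (\<lambda>x. 0) \<Longrightarrow> \<forall>j<n. c j = 0"
    "\<And>f. smooth f \<Longrightarrow> diff_op cs (\<lambda>x. \<Sum>j<n. u j x * integral_from a (\<lambda>\<xi>. v j \<xi> * f \<xi>) x) = f"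
proof -
  let ?A = "companion_matrix cs"
  have smA: "smooth (?A i k)" if "k < n" for i k
    using smooth_companion_matrix cs that n by auto
  obtain Y Z where
    smY: "\<And>i j. i < n \<Longrightarrow> j < n \<Longrightarrow> smooth (Y i j)"
    and smZ: "\<And>i j. i < n \<Longrightarrow> j < n \<Longrightarrow> smooth (Z i j)"
    and derY: "\<And>i j x. i < n \<Longrightarrow> j < n \<Longrightarrow>
      (Y i j has_vector_derivative (\<Sum>k<n. ?A i k x * Y k j x)) (at x)"
    and YZ: "\<And>i j x. i < n \<Longrightarrow> j < n \<Longrightarrow> (\<Sum>k<n. Y i k x * Z k j x) = of_bool (i = j)"
    and ZY: "\<And>i j x. i < n \<Longrightarrow> j < n \<Longrightarrow> (\<Sum>k<n. Z i k x * Y k j x) = of_bool (i = j)"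
    by (rule fundamental_matrix[of n ?A]) (use smA in auto)
  define v where "v j = Z j (n - 1)" for j
  have der0: "(Y i j has_vector_derivative
      (\<Sum>k<n. ?A i k x * Y k j x) + of_bool (Suc i = n) * 0) (at x)" if "i < n" "j < n" for i j x
    using derY[OF that] by simp
  have ddxY: "(ddx ^^ i) (Y 0 j) = Y i j" if "i < n" "j < n" for i j
    by (rule companion_system_solution(1)[where y="\<lambda>i. Y i j" and f="\<lambda>x. 0", OF n der0 \<open>i < n\<close>])
       (use that in auto)
  show thesis
  proof (rule that[of "Y 0" v])
    show "smooth (Y 0 j)" "smooth (v j)" if "j < n" for j
      using smY smZ n that by (auto simp: v_def)
    show "diff_op cs (Y 0 j) = (\<lambda>x. 0)" if "j < n" for j
      by (rule companion_system_solution(2)[where y="\<lambda>i. Y i j", OF n der0]) (use that in auto)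
    show "\<forall>j<n. c j = 0" if zero: "(\<lambda>x. \<Sum>j<n. c j * Y 0 j x) = (\<lambda>x. 0)" for c
    proof (intro allI impI)
      fix l assume "l < n"
      have Yc: "(\<Sum>j<n. Y i j 0 * c j) = 0" if "i < n" for i
      proof -
        have "(ddx ^^ i) (\<lambda>x. \<Sum>j<n. c j * Y 0 j x) = (\<lambda>x. \<Sum>j<n. (ddx ^^ i) (\<lambda>x. c j * Y 0 j x) x)"
          by (intro ddx_funpow_sum smooth_mult smooth_const smY) (use n in auto)
        also have "\<dots> = (\<lambda>x. \<Sum>j<n. c j * Y i j x)"
          by (intro ext sum.cong) (use n that smY in \<open>auto simp: ddx_funpow_cmult ddxY\<close>)
        finally show ?thesis
          unfolding zero ddx_funpow_zero by (auto simp: fun_eq_iff mult.commute)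
      qed
      have "c l = (\<Sum>j<n. of_bool (l = j) * c j)"
        using \<open>l < n\<close> by (simp add: of_bool_def if_distrib[of "\<lambda>t. t * _"] cong: if_cong)
      also have "\<dots> = (\<Sum>j<n. (\<Sum>i<n. Z l i 0 * Y i j 0) * c j)"
        by (intro sum.cong) (use \<open>l < n\<close> in \<open>auto simp: ZY\<close>)
      also have "\<dots> = (\<Sum>i<n. Z l i 0 * (\<Sum>j<n. Y i j 0 * c j))"
        unfolding sum_distrib_right sum_distrib_left by (subst sum.swap) (simp add: mult_ac)
      also have "\<dots> = 0" using Yc by simp
      finally show "c l = 0" .
    qed
    show "diff_op cs (\<lambda>x. \<Sum>j<n. Y 0 j x * integral_from a (\<lambda>\<xi>. v j \<xi> * f \<xi>) x) = f"
      if f: "smooth f" for f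
    proof (rule companion_system_solution(2)[where
          y="\<lambda>i x. \<Sum>j<n. Y i j x * integral_from a (\<lambda>\<xi>. v j \<xi> * f \<xi>) x", OF n])
      fix i x assume i: "i < n"
      let ?I = "\<lambda>j. integral_from a (\<lambda>\<xi>. v j \<xi> * f \<xi>) x"
      have smv: "smooth (v j)" if "j < n" for j using smZ n that by (auto simp: v_def)
      have "((\<lambda>x. \<Sum>j<n. Y i j x * integral_from a (\<lambda>\<xi>. v j \<xi> * f \<xi>) x) has_vector_derivative
          (\<Sum>j<n. Y i j x * (v j x * f x) + (\<Sum>k<n. ?A i k x * Y k j x) * ?I j)) (at x)"
        by (intro has_vector_derivative_sum has_vector_derivative_mult derY
              has_vector_derivative_integral_from smooth_continuous_on smooth_mult f smv)
           (use i in auto)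
      also have "(\<Sum>j<n. Y i j x * (v j x * f x) + (\<Sum>k<n. ?A i k x * Y k j x) * ?I j) =
          (\<Sum>j<n. \<Sum>k<n. ?A i k x * (Y k j x * ?I j)) + (\<Sum>j<n. Y i j x * v j x) * f x"
        by (simp add: sum.distrib sum_distrib_left sum_distrib_right mult_ac)
      also have "(\<Sum>j<n. \<Sum>k<n. ?A i k x * (Y k j x * ?I j)) = (\<Sum>k<n. ?A i k x * (\<Sum>j<n. Y k j x * ?I j))"
        by (subst sum.swap) (simp add: sum_distrib_left)
      also have "(\<Sum>j<n. Y i j x * v j x) = of_bool (Suc i = n)"
        unfolding v_def using YZ[of i "n - 1" x] i n by (auto simp: of_bool_def)
      finally show "((\<lambda>x. \<Sum>j<n. Y i j x * integral_from a (\<lambda>\<xi>. v j \<xi> * f \<xi>) x) has_vector_derivative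
          (\<Sum>k<n. ?A i k x * (\<Sum>j<n. Y k j x * ?I j)) + of_bool (Suc i = n) * f x) (at x)" .
    qed
  qed
qed

section \<open>Sums of elementary operators\<close>

fun op_point :: "'k elem_op \<Rightarrow> real" where
  "op_point (IntegOp f \<alpha> g) = \<alpha>"
| "op_point (EvalOp f \<alpha> i) = \<alpha>"

definition op_sum :: "'k::{real_normed_field,euclidean_space} elem_op list \<Rightarrow> (real \<Rightarrow> 'k) \<Rightarrow> real \<Rightarrow> 'k" where
  "op_sum ops f = (\<lambda>x. \<Sum>p\<leftarrow>ops. op_apply p f x)"

text \<open>
  An operator is in Green form over \<open>A\<close> if on smooth functions it is a sum of elementary operators with
  points in \<open>A\<close>. A linear functional is treated as an operator whose values are constant functions;
  then left multiplication by a function turns functionals into operators of rank one.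
\<close>

definition green_form ::
  "real set \<Rightarrow> ((real \<Rightarrow> 'k::{real_normed_field,euclidean_space}) \<Rightarrow> real \<Rightarrow> 'k) \<Rightarrow> bool" where
  "green_form A G \<longleftrightarrow> (\<exists>ops. (\<forall>p\<in>set ops. smooth_op p \<and> op_point p \<in> A) \<and>
     (\<forall>f. smooth f \<longrightarrow> G f = op_sum ops f))"

lemma green_form_cong:
  "green_form A G \<Longrightarrow> (\<And>f. smooth f \<Longrightarrow> H f = G f) \<Longrightarrow> green_form A H"
  by (simp add: green_form_def)

lemma green_form_zero: "green_form A (\<lambda>f x. 0)"
  unfolding green_form_def by (rule exI[of _ "[]"]) (simp add: op_sum_def)

lemma green_form_add:
  assumes "green_form A G" "green_form A H"
  shows "green_form A (\<lambda>f x. G f x + H f x)"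
proof -
  obtain p q where "\<forall>r\<in>set p. smooth_op r \<and> op_point r \<in> A" "\<forall>f. smooth f \<longrightarrow> G f = op_sum p f"
    "\<forall>r\<in>set q. smooth_op r \<and> op_point r \<in> A" "\<forall>f. smooth f \<longrightarrow> H f = op_sum q f"
    using assms unfolding green_form_def by blast
  then show ?thesis
    unfolding green_form_def by (intro exI[of _ "p @ q"]) (auto simp: op_sum_def)
qed

lemma green_form_sum:
  "(\<And>i. i \<in> I \<Longrightarrow> green_form A (G i)) \<Longrightarrow> green_form A (\<lambda>f x. \<Sum>i\<in>I. G i f x)"
  by (induction I rule: infinite_finite_induct) (simp_all add: green_form_zero green_form_add)

fun scale_op :: "(real \<Rightarrow> 'k::{real_normed_field,euclidean_space}) \<Rightarrow> 'k elem_op \<Rightarrow> 'k elem_op" where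
  "scale_op u (IntegOp f \<alpha> g) = IntegOp (\<lambda>x. u x * f x) \<alpha> g"
| "scale_op u (EvalOp f \<alpha> i) = EvalOp (\<lambda>x. u x * f x) \<alpha> i"

lemma op_apply_scale_op: "op_apply (scale_op u p) f x = u x * op_apply p f x"
  by (cases p) (auto simp: mult.assoc)

lemma op_point_scale_op: "op_point (scale_op u p) = op_point p"
  by (cases p) auto

lemma smooth_op_scale_op: "smooth u \<Longrightarrow> smooth_op p \<Longrightarrow> smooth_op (scale_op u p)"
  by (cases p) (auto intro: smooth_mult)

lemma op_sum_scale_op: "op_sum (map (scale_op u) p) f x = u x * op_sum p f x"
  unfolding op_sum_def by (induction p) (auto simp: op_apply_scale_op algebra_simps)

lemma green_form_mult:
  assumes "smooth u" "green_form A G"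
  shows "green_form A (\<lambda>f x. u x * G f x)"
proof -
  obtain p where p: "\<forall>r\<in>set p. smooth_op r \<and> op_point r \<in> A" "\<forall>f. smooth f \<longrightarrow> G f = op_sum p f"
    using assms unfolding green_form_def by blast
  show ?thesis
    unfolding green_form_def
    by (intro exI[of _ "map (scale_op u) p"])
       (use p assms(1) in \<open>auto simp: op_sum_scale_op op_point_scale_op smooth_op_scale_op fun_eq_iff\<close>)
qed

lemma green_form_cmult: "green_form A G \<Longrightarrow> green_form A (\<lambda>f x. c * G f x)"
  using green_form_mult[OF smooth_const] .

lemma green_form_diff:
  assumes "green_form A G" "green_form A H"
  shows "green_form A (\<lambda>f x. G f x - H f x)"
  using green_form_add[OF assms(1) green_form_cmult[OF assms(2), of "-1"]] by simp

lemma green_form_integral: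
  assumes "\<alpha> \<in> A" "smooth q"
  shows "green_form A (\<lambda>f x. integral_from \<alpha> (\<lambda>\<xi>. q \<xi> * f \<xi>) x)"
  unfolding green_form_def
  by (rule exI[of _ "[IntegOp (\<lambda>x. 1) \<alpha> q]"]) (use assms in \<open>auto simp: op_sum_def smooth_const\<close>)

lemma green_form_eval: "\<phi> \<in> A \<Longrightarrow> green_form A (\<lambda>f x. (ddx ^^ i) f \<phi>)"
  unfolding green_form_def
  by (rule exI[of _ "[EvalOp (\<lambda>x. 1) \<phi> i]"]) (auto simp: op_sum_def smooth_const)

text \<open>
  An elementary operator integrates up to \<open>x\<close>, but the difference of those based at \<open>\<alpha>\<close> and at \<open>\<phi>\<close>
  does not depend on \<open>x\<close>.
\<close>

lemma green_form_definite_integral: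
  assumes "\<alpha> \<in> A" "\<phi> \<in> A" "smooth q"
  shows "green_form A (\<lambda>f x. integral_from \<alpha> (\<lambda>\<xi>. q \<xi> * f \<xi>) \<phi>)"
proof (rule green_form_cong)
  show "green_form A (\<lambda>f x. integral_from \<alpha> (\<lambda>\<xi>. q \<xi> * f \<xi>) x - integral_from \<phi> (\<lambda>\<xi>. q \<xi> * f \<xi>) x)"
    by (intro green_form_diff green_form_integral assms)
  show "(\<lambda>x. integral_from \<alpha> (\<lambda>\<xi>. q \<xi> * f \<xi>) \<phi>) =
      (\<lambda>x. integral_from \<alpha> (\<lambda>\<xi>. q \<xi> * f \<xi>) x - integral_from \<phi> (\<lambda>\<xi>. q \<xi> * f \<xi>) x)"
    if "smooth f" for f
  proof
    fix x
    have "integral_from \<phi> (\<lambda>\<xi>. q \<xi> * f \<xi>) x =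
        integral_from \<alpha> (\<lambda>\<xi>. q \<xi> * f \<xi>) x - integral_from \<alpha> (\<lambda>\<xi>. q \<xi> * f \<xi>) \<phi>"
      by (intro integral_from_eq_diff has_vector_derivative_integral_from smooth_continuous_on
            smooth_mult assms that)
    then show "integral_from \<alpha> (\<lambda>\<xi>. q \<xi> * f \<xi>) \<phi> =
        integral_from \<alpha> (\<lambda>\<xi>. q \<xi> * f \<xi>) x - integral_from \<phi> (\<lambda>\<xi>. q \<xi> * f \<xi>) x" by simp
  qed
qed

text \<open>
  This is the Leibniz rule, one derivative at a time: both resulting terms again are products of a
  smooth coefficient and a derivative of \<open>f\<close>, of which one less derivative is taken.
\<close>

lemma green_form_eval_product:
  assumes "\<phi> \<in> A" "smooth w"
  shows "green_form A (\<lambda>f x. (ddx ^^ k) (\<lambda>t. w t * (ddx ^^ l) f t) \<phi>)"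
  using assms(2)
proof (induction k arbitrary: w l)
  case 0
  show ?case using green_form_cmult[OF green_form_eval[OF assms(1)], of "w \<phi>" l] by simp
next
  case (Suc k)
  show ?case
  proof (rule green_form_cong)
    show "green_form A (\<lambda>f x. (ddx ^^ k) (\<lambda>t. w t * (ddx ^^ Suc l) f t) \<phi> +
        (ddx ^^ k) (\<lambda>t. ddx w t * (ddx ^^ l) f t) \<phi>)"
      by (intro green_form_add Suc smooth_ddx)
    show "(\<lambda>x. (ddx ^^ Suc k) (\<lambda>t. w t * (ddx ^^ l) f t) \<phi>) =
        (\<lambda>x. (ddx ^^ k) (\<lambda>t. w t * (ddx ^^ Suc l) f t) \<phi> +
          (ddx ^^ k) (\<lambda>t. ddx w t * (ddx ^^ l) f t) \<phi>)" if f: "smooth f" for f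
    proof -
      have "ddx (\<lambda>t. w t * (ddx ^^ l) f t) = (\<lambda>t. w t * (ddx ^^ Suc l) f t + ddx w t * (ddx ^^ l) f t)"
        using ddx_mult[OF Suc.prems smooth_ddx_funpow[OF f, of l]] by simp
      moreover have "smooth (\<lambda>t. w t * (ddx ^^ Suc l) f t)" "smooth (\<lambda>t. ddx w t * (ddx ^^ l) f t)"
        by (intro smooth_mult smooth_ddx_funpow smooth_ddx Suc.prems f)+
      ultimately show ?thesis
        by (simp add: funpow_Suc_right ddx_funpow_add del: funpow.simps)
    qed
  qed
qed

text \<open>
  A derivative either falls on the coefficient \<open>u\<close> or removes the integral sign. In the second case
  derivatives of \<open>f\<close> at \<open>\<phi>\<close> appear; boundary conditions of high order lead to Dirac distributions in
  this way.
\<close>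

lemma green_form_eval_integral:
  assumes "a \<in> A" "\<phi> \<in> A" "smooth u" "smooth v"
  shows "green_form A (\<lambda>f x. (ddx ^^ k) (\<lambda>t. u t * integral_from a (\<lambda>\<xi>. v \<xi> * f \<xi>) t) \<phi>)"
  using assms(3)
proof (induction k arbitrary: u)
  case 0
  show ?case
    using green_form_cmult[OF green_form_definite_integral[OF assms(1,2,4)], of "u \<phi>"] by simp
next
  case (Suc k)
  show ?case
  proof (rule green_form_cong)
    show "green_form A (\<lambda>f x. (ddx ^^ k) (\<lambda>t. (u t * v t) * (ddx ^^ 0) f t) \<phi> +
        (ddx ^^ k) (\<lambda>t. ddx u t * integral_from a (\<lambda>\<xi>. v \<xi> * f \<xi>) t) \<phi>)"
      by (intro green_form_add Suc smooth_ddx green_form_eval_product smooth_mult assms)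
    show "(\<lambda>x. (ddx ^^ Suc k) (\<lambda>t. u t * integral_from a (\<lambda>\<xi>. v \<xi> * f \<xi>) t) \<phi>) =
        (\<lambda>x. (ddx ^^ k) (\<lambda>t. (u t * v t) * (ddx ^^ 0) f t) \<phi> +
        (ddx ^^ k) (\<lambda>t. ddx u t * integral_from a (\<lambda>\<xi>. v \<xi> * f \<xi>) t) \<phi>)" if f: "smooth f" for f
    proof -
      have sm: "smooth (\<lambda>\<xi>. v \<xi> * f \<xi>)" by (intro smooth_mult assms f)
      have "ddx (\<lambda>t. u t * integral_from a (\<lambda>\<xi>. v \<xi> * f \<xi>) t) =
          (\<lambda>t. (u t * v t) * (ddx ^^ 0) f t + ddx u t * integral_from a (\<lambda>\<xi>. v \<xi> * f \<xi>) t)"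
        using ddx_mult[OF Suc.prems smooth_integral_from[OF sm, of a]]
        by (simp add: ddx_integral_from[OF sm] mult.assoc)
      moreover have "smooth (\<lambda>t. (u t * v t) * (ddx ^^ 0) f t)"
        "smooth (\<lambda>t. ddx u t * integral_from a (\<lambda>\<xi>. v \<xi> * f \<xi>) t)"
        by (intro smooth_mult smooth_ddx_funpow smooth_ddx smooth_integral_from sm assms Suc.prems f)+
      ultimately show ?thesis
        by (simp add: funpow_Suc_right ddx_funpow_add del: funpow.simps)
    qed
  qed
qed

text \<open>
  Integration by parts removes the double integral: if \<open>W\<close> is a primitive of \<open>w u\<close>, then
  \<open>W(t) \<integral>\<^sub>a\<^sup>t v f - \<integral>\<^sub>a\<^sup>t W v f\<close> is a primitive of the outer integrand.
\<close>

lemma green_form_iterated_integral: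
  assumes A: "a \<in> A" "\<psi> \<in> A" "\<phi> \<in> A" and sm: "smooth w" "smooth u" "smooth v"
  shows "green_form A (\<lambda>f x. integral_from \<psi> (\<lambda>t. w t * (u t * integral_from a (\<lambda>\<xi>. v \<xi> * f \<xi>) t)) \<phi>)"
proof -
  define W where "W = integral_from a (\<lambda>t. w t * u t)"
  have smwu: "smooth (\<lambda>t. w t * u t)" by (intro smooth_mult sm)
  have smW: "smooth W" unfolding W_def by (intro smooth_integral_from smwu)
  define F where "F f t = W t * integral_from a (\<lambda>\<xi>. v \<xi> * f \<xi>) t -
      integral_from a (\<lambda>\<xi>. (W \<xi> * v \<xi>) * f \<xi>) t" for f t
  have F: "green_form A (\<lambda>f x. F f t)" if "t \<in> A" for t
    unfolding F_def
    by (intro green_form_diff green_form_cmult green_form_definite_integral A that sm smooth_mult smW)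
  show ?thesis
  proof (rule green_form_cong)
    show "green_form A (\<lambda>f x. F f \<phi> - F f \<psi>)" by (intro green_form_diff F A)
    show "(\<lambda>x. integral_from \<psi> (\<lambda>t. w t * (u t * integral_from a (\<lambda>\<xi>. v \<xi> * f \<xi>) t)) \<phi>) =
        (\<lambda>x. F f \<phi> - F f \<psi>)" if f: "smooth f" for f
    proof
      fix x
      have smf: "smooth (\<lambda>\<xi>. v \<xi> * f \<xi>)" "smooth (\<lambda>\<xi>. (W \<xi> * v \<xi>) * f \<xi>)"
        by (intro smooth_mult sm f smW)+
      show "integral_from \<psi> (\<lambda>t. w t * (u t * integral_from a (\<lambda>\<xi>. v \<xi> * f \<xi>) t)) \<phi> = F f \<phi> - F f \<psi>"
      proof (rule integral_from_eq_diff)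
        fix t
        have "(F f has_vector_derivative
            (W t * (v t * f t) + (w t * u t) * integral_from a (\<lambda>\<xi>. v \<xi> * f \<xi>) t) - (W t * v t) * f t) (at t)"
          unfolding F_def W_def
          by (intro has_vector_derivative_diff has_vector_derivative_mult
                has_vector_derivative_integral_from smooth_continuous_on smf[unfolded W_def] smwu)
        then show "(F f has_vector_derivative w t * (u t * integral_from a (\<lambda>\<xi>. v \<xi> * f \<xi>) t)) (at t)"
          by (simp add: mult.assoc)
      next
        show "continuous_on UNIV (\<lambda>t. w t * (u t * integral_from a (\<lambda>\<xi>. v \<xi> * f \<xi>) t))"
          by (intro smooth_continuous_on smooth_mult sm smooth_integral_from f)
      qed
    qed
  qed
qed

section \<open>Stieltjes conditions\<close>

lemma integral_from_add:
  fixes f g :: "real \<Rightarrow> 'k::{real_normed_field,euclidean_space}"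
  assumes "smooth f" "smooth g"
  shows "integral_from a (\<lambda>x. f x + g x) b = integral_from a f b + integral_from a g b"
proof -
  have "integral_from a (\<lambda>x. f x + g x) b =
      (integral_from a f b + integral_from a g b) - (integral_from a f a + integral_from a g a)"
    by (intro integral_from_eq_diff has_vector_derivative_add has_vector_derivative_integral_from
          smooth_continuous_on smooth_add assms)
  then show ?thesis by simp
qed

lemma integral_from_cmult:
  fixes f :: "real \<Rightarrow> 'k::{real_normed_field,euclidean_space}"
  shows "integral_from a (\<lambda>x. c * f x) b = c * integral_from a f b"
  by (rule interval_lebesgue_integral_mult_right)

lemma stieltjes_condition_weight: "stieltjes_condition \<beta> \<Longrightarrow> smooth (weight \<beta> \<phi>)"
  by (simp add: stieltjes_condition_def)

lemma stieltjes_apply_add: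
  assumes "stieltjes_condition \<beta>" "smooth u" "smooth v"
  shows "stieltjes_apply \<beta> (\<lambda>x. u x + v x) = stieltjes_apply \<beta> u + stieltjes_apply \<beta> v"
  unfolding stieltjes_apply_def
  by (simp add: ddx_funpow_add assms distrib_left sum.distrib split_def
        integral_from_add smooth_mult stieltjes_condition_weight)

lemma stieltjes_apply_cmult:
  assumes "smooth u"
  shows "stieltjes_apply \<beta> (\<lambda>x. c * u x) = c * stieltjes_apply \<beta> u"
proof -
  have "integral_from 0 (\<lambda>\<xi>. weight \<beta> \<phi> \<xi> * (c * u \<xi>)) \<phi> = c * integral_from 0 (\<lambda>\<xi>. weight \<beta> \<phi> \<xi> * u \<xi>) \<phi>"
    for \<phi>
    unfolding integral_from_cmult[symmetric] by (simp only: mult.left_commute)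
  then show ?thesis
    by (simp add: stieltjes_apply_def ddx_funpow_cmult assms distrib_left sum_distrib_left split_def mult.left_commute)
qed

lemma stieltjes_apply_zero: "stieltjes_apply \<beta> (\<lambda>x. 0) = 0"
  by (simp add: stieltjes_apply_def ddx_funpow_zero)

lemma stieltjes_apply_sum:
  assumes "stieltjes_condition \<beta>" "\<And>j. j \<in> I \<Longrightarrow> smooth (u j)"
  shows "stieltjes_apply \<beta> (\<lambda>x. \<Sum>j\<in>I. u j x) = (\<Sum>j\<in>I. stieltjes_apply \<beta> (u j))"
  using assms(2)
  by (induction I rule: infinite_finite_induct)
     (simp_all add: stieltjes_apply_zero stieltjes_apply_add assms(1) smooth_sum)

text \<open>
  The points that occur are the base point, the points of the local conditions, and both end points of
  each integral. For the integrals, this is where \<open>0\<close> has to be an evaluation point.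
\<close>

lemma green_form_stieltjes:
  assumes \<beta>: "stieltjes_condition \<beta>" "eval_points \<beta> \<subseteq> A" and a: "a \<in> A"
    and sm: "smooth u" "smooth v"
  shows "green_form A (\<lambda>f x. stieltjes_apply \<beta> (\<lambda>t. u t * integral_from a (\<lambda>\<xi>. v \<xi> * f \<xi>) t))"
  unfolding stieltjes_apply_def
proof (intro green_form_add green_form_sum)
  fix p assume "p \<in> local_support \<beta>"
  moreover obtain \<phi> i where p: "p = (\<phi>, i)" by (cases p)
  ultimately have "\<phi> \<in> A" using \<beta>(2) by (force simp: eval_points_def)
  then show "green_form A (\<lambda>f x. case p of (\<phi>, i) \<Rightarrow>
      local_coeff \<beta> \<phi> i * (ddx ^^ i) (\<lambda>t. u t * integral_from a (\<lambda>\<xi>. v \<xi> * f \<xi>) t) \<phi>)"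
    unfolding p prod.case by (intro green_form_cmult green_form_eval_integral a sm)
next
  fix \<phi> assume "\<phi> \<in> global_support \<beta>"
  then have "\<phi> \<in> A" "0 \<in> A" using \<beta>(2) by (auto simp: eval_points_def split: if_splits)
  then show "green_form A (\<lambda>f x. integral_from 0
      (\<lambda>t. weight \<beta> \<phi> t * (u t * integral_from a (\<lambda>\<xi>. v \<xi> * f \<xi>) t)) \<phi>)"
    by (intro green_form_iterated_integral a sm stieltjes_condition_weight \<beta>)
qed

section \<open>The Green's operator\<close>

text \<open>
  A boundary problem of positive order has an evaluation point that can serve as the base point of the
  integrals: without one, all conditions would be zero and thus linearly dependent.
\<close>

lemma eval_points_nonempty:
  assumes "0 < n" "boundary_problem n cs \<beta>s"
  shows "(\<Union>\<beta>\<in>set \<beta>s. eval_points \<beta>) \<noteq> {}"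
proof
  assume empty: "(\<Union>\<beta>\<in>set \<beta>s. eval_points \<beta>) = {}"
  have zero: "stieltjes_apply (\<beta>s ! k) u = 0" if "k < n" for k u
  proof -
    have "eval_points (\<beta>s ! k) = {}"
      using empty that assms(2) by (auto simp: boundary_problem_def)
    then have "local_support (\<beta>s ! k) = {}" "global_support (\<beta>s ! k) = {}"
      by (auto simp: eval_points_def)
    then show ?thesis by (simp add: stieltjes_apply_def)
  qed
  have "\<forall>k<n. (1::'a) = 0"
    using assms(2) zero unfolding boundary_problem_def
    by (elim conjE allE[where x="\<lambda>_. 1"]) simp
  then show False using assms(1) by auto
qed

lemma greens_operator_eqI:
  assumes "regular_problem cs \<beta>s" "smooth f" "solves cs \<beta>s f u"
  shows "greens_operator cs \<beta>s f = u"
  unfolding greens_operator_def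
  using assms by (intro the1_equality) (auto simp: regular_problem_def)

text \<open>
  Let \<open>T\<close> be the right inverse given by variation of constants, based at an evaluation point. The
  solution is \<open>T f\<close> corrected by a combination of the fundamental solutions \<open>u\<^sub>j\<close>. The coefficients
  satisfy a linear system with the matrix \<open>\<beta>\<^sub>i(u\<^sub>j)\<close>. By regularity, \<open>0\<close> is the only solution of the
  homogeneous boundary problem, so this matrix is injective; being square, it is invertible. Hence the
  coefficients are fixed linear combinations of the functionals \<open>f \<mapsto> \<beta>\<^sub>i(T f)\<close>, which are in Green form.
\<close>

lemma green_form_greens_operator:
  fixes cs :: "(real \<Rightarrow> 'k::{real_normed_field,euclidean_space}) list"
  assumes "0 < n" and bp: "boundary_problem n cs \<beta>s" and reg: "regular_problem cs \<beta>s"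
  shows "green_form (\<Union>\<beta>\<in>set \<beta>s. eval_points \<beta>) (greens_operator cs \<beta>s)"
proof -
  let ?A = "\<Union>\<beta>\<in>set \<beta>s. eval_points \<beta>"
  obtain a where a: "a \<in> ?A"
    using eval_points_nonempty[OF assms(1,2)] by blast
  have n: "n = length cs" "length \<beta>s = n" and cs: "\<forall>c\<in>set cs. smooth c"
    and sc: "\<And>i. i < n \<Longrightarrow> stieltjes_condition (\<beta>s ! i)"
    using bp by (auto simp: boundary_problem_def)
  have sub: "eval_points (\<beta>s ! i) \<subseteq> ?A" if "i < n" for i
    using that n(2) nth_mem[of i \<beta>s] by blast
  obtain u v where smu: "\<And>j. j < n \<Longrightarrow> smooth (u j)" and smv: "\<And>j. j < n \<Longrightarrow> smooth (v j)"
    and Tu: "\<And>j. j < n \<Longrightarrow> diff_op cs (u j) = (\<lambda>x. 0)"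
    and indep: "\<And>c. (\<lambda>x. \<Sum>j<n. c j * u j x) = (\<lambda>x. 0) \<Longrightarrow> \<forall>j<n. c j = 0"
    and inv: "\<And>f. smooth f \<Longrightarrow> diff_op cs (\<lambda>x. \<Sum>j<n. u j x * integral_from a (\<lambda>\<xi>. v j \<xi> * f \<xi>) x) = f"
    by (rule variation_of_constants[OF n(1) assms(1) cs, of a]) (rule that)
  define M where "M i j = stieltjes_apply (\<beta>s ! i) (u j)" for i j
  have sm_comb: "smooth (\<lambda>x. \<Sum>j<n. c j * u j x)" for c :: "nat \<Rightarrow> 'k"
    by (intro smooth_sum smooth_mult smooth_const smu) auto
  have T_comb: "diff_op cs (\<lambda>x. \<Sum>j<n. c j * u j x) = (\<lambda>x. 0)" for c :: "nat \<Rightarrow> 'k"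
    by (subst diff_op_sum)
       (auto simp: diff_op_cmult smu Tu intro!: smooth_mult smooth_const)
  have \<beta>_comb: "stieltjes_apply (\<beta>s ! i) (\<lambda>x. \<Sum>j<n. c j * u j x) = (\<Sum>j<n. M i j * c j)"
    if "i < n" for i and c :: "nat \<Rightarrow> 'k"
    by (subst stieltjes_apply_sum[OF sc[OF that]])
       (auto simp: stieltjes_apply_cmult smu M_def mult.commute intro!: smooth_mult smooth_const)
  have injM: "\<forall>j<n. c j = 0" if "\<And>i. i < n \<Longrightarrow> (\<Sum>j<n. M i j * c j) = 0" for c
  proof (rule indep)
    have "solves cs \<beta>s (\<lambda>x. 0) (\<lambda>x. \<Sum>j<n. c j * u j x)"
      unfolding solves_def by (auto simp: sm_comb T_comb in_set_conv_nth n(2) \<beta>_comb that)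
    moreover have "solves cs \<beta>s (\<lambda>x. 0) (\<lambda>x. 0)"
      unfolding solves_def by (auto simp: smooth_const diff_op_zero stieltjes_apply_zero)
    ultimately show "(\<lambda>x. \<Sum>j<n. c j * u j x) = (\<lambda>x. 0)"
      using greens_operator_eqI[OF reg smooth_const] by metis
  qed
  obtain N where N: "\<And>i l. i < n \<Longrightarrow> l < n \<Longrightarrow> (\<Sum>j<n. M i j * N j l) = of_bool (i = l)"
    by (rule injective_imp_right_inverse[of n M, OF injM]) (blast intro: that)+
  define T where "T f x = (\<Sum>j<n. u j x * integral_from a (\<lambda>\<xi>. v j \<xi> * f \<xi>) x)" for f x
  define c where "c f j = - (\<Sum>l<n. N j l * stieltjes_apply (\<beta>s ! l) (T f))" for f j
  have smTj: "smooth (\<lambda>x. u j x * integral_from a (\<lambda>\<xi>. v j \<xi> * f \<xi>) x)" if "smooth f" "j < n" for f j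
    by (intro smooth_mult smooth_integral_from smu smv that)
  have smT: "smooth (T f)" if "smooth f" for f
    unfolding T_def by (rule smooth_sum) (use smTj that in auto)
  have G: "greens_operator cs \<beta>s f = (\<lambda>x. T f x + (\<Sum>j<n. c f j * u j x))" if f: "smooth f" for f
  proof (rule greens_operator_eqI[OF reg f])
    have "stieltjes_apply (\<beta>s ! i) (\<lambda>x. T f x + (\<Sum>j<n. c f j * u j x)) = 0" if "i < n" for i
    proof -
      have "(\<Sum>j<n. M i j * c f j) = - (\<Sum>l<n. (\<Sum>j<n. M i j * N j l) * stieltjes_apply (\<beta>s ! l) (T f))"
        unfolding c_def sum_distrib_right
        by (subst sum.swap) (simp add: sum_distrib_left sum_negf mult.assoc)
      also have "\<dots> = - (\<Sum>l<n. of_bool (i = l) * stieltjes_apply (\<beta>s ! l) (T f))"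
        using N that by simp
      also have "\<dots> = - stieltjes_apply (\<beta>s ! i) (T f)"
        using that by (simp add: of_bool_def if_distrib[of "\<lambda>t. t * _"] cong: if_cong)
      finally show ?thesis
        using stieltjes_apply_add[OF sc[OF that] smT[OF f] sm_comb] \<beta>_comb[OF that] by simp
    qed
    moreover have "diff_op cs (T f) = f"
      unfolding T_def by (rule inv[OF f])
    ultimately show "solves cs \<beta>s f (\<lambda>x. T f x + (\<Sum>j<n. c f j * u j x))"
      unfolding solves_def
      by (auto simp: in_set_conv_nth n(2) diff_op_add[OF smT[OF f] sm_comb] T_comb
            intro!: smooth_add smT f sm_comb)
  qed
  have \<beta>T: "green_form ?A (\<lambda>f x. stieltjes_apply (\<beta>s ! i) (T f))" if "i < n" for i
  proof (rule green_form_cong)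
    show "green_form ?A (\<lambda>f x. \<Sum>j<n. stieltjes_apply (\<beta>s ! i)
        (\<lambda>x. u j x * integral_from a (\<lambda>\<xi>. v j \<xi> * f \<xi>) x))"
      by (intro green_form_sum green_form_stieltjes a sc sub smu smv) (use that in auto)
    show "(\<lambda>x. stieltjes_apply (\<beta>s ! i) (T f)) = (\<lambda>x. \<Sum>j<n. stieltjes_apply (\<beta>s ! i)
        (\<lambda>x. u j x * integral_from a (\<lambda>\<xi>. v j \<xi> * f \<xi>) x))" if "smooth f" for f
      unfolding T_def using smTj[OF that] by (subst stieltjes_apply_sum[OF sc[OF \<open>i < n\<close>]]) auto
  qed
  show ?thesis
  proof (rule green_form_cong[OF _ G])
    have "green_form ?A (\<lambda>f x. u j x * (-1 * (\<Sum>l<n. N j l * stieltjes_apply (\<beta>s ! l) (T f))))" if "j < n" for j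
      by (intro green_form_mult green_form_cmult green_form_sum \<beta>T smu) (use that in auto)
    then have "green_form ?A (\<lambda>f x. c f j * u j x)" if "j < n" for j
      using that by (simp add: c_def mult.commute)
    then show "green_form ?A (\<lambda>f x. T f x + (\<Sum>j<n. c f j * u j x))"
      unfolding T_def
      by (intro green_form_add green_form_sum green_form_mult green_form_integral a smu smv) auto
  qed
qed

section \<open>Kernels\<close>

lemma fst_kernel_of: "fst (kernel_of ops) x \<xi> = (\<Sum>p\<leftarrow>ops. fst (op_kernel p) x \<xi>)"
  and snd_kernel_of: "snd (kernel_of ops) \<alpha> i x = (\<Sum>p\<leftarrow>ops. snd (op_kernel p) \<alpha> i x)"
  by (simp_all add: kernel_of_def)

text \<open>
  The Dirac distributions that an operator can contribute to a kernel; a finite index set that,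
  unlike the set of nonzero coefficients, does not depend on \<open>x\<close>.
\<close>

fun eval_orders :: "'k elem_op \<Rightarrow> (real \<times> nat) set" where
  "eval_orders (IntegOp f \<alpha> g) = {}"
| "eval_orders (EvalOp f \<alpha> i) = {(\<alpha>, i)}"

lemma finite_eval_orders: "finite (\<Union>p\<in>set ops. eval_orders p)"
proof -
  have "finite (eval_orders p)" for p :: "'k elem_op" by (cases p) auto
  then show ?thesis by auto
qed

lemma eval_orders_point: "(\<alpha>, i) \<in> eval_orders p \<Longrightarrow> \<alpha> = op_point p"
  by (cases p) auto

lemma snd_op_kernel_nonzero: "snd (op_kernel p) \<alpha> i x \<noteq> 0 \<Longrightarrow> (\<alpha>, i) \<in> eval_orders p"
  by (cases p) (auto simp: dirac_def split: if_splits)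

lemma snd_kernel_of_nonzero:
  assumes "snd (kernel_of ops) \<alpha> i x \<noteq> 0"
  shows "(\<alpha>, i) \<in> (\<Union>p\<in>set ops. eval_orders p)"
proof (rule ccontr)
  assume "\<not> ?thesis"
  then have "snd (op_kernel p) \<alpha> i x = 0" if "p \<in> set ops" for p
    using snd_op_kernel_nonzero[of p \<alpha> i x] that by blast
  then have "(\<Sum>p\<leftarrow>ops. snd (op_kernel p) \<alpha> i x) = 0"
    by (induction ops) auto
  then show False using assms by (simp add: snd_kernel_of)
qed

lemma smooth_snd_kernel_of:
  assumes "\<forall>p\<in>set ops. smooth_op p"
  shows "smooth (snd (kernel_of ops) \<alpha> i)"
proof -
  have "smooth (snd (op_kernel p) \<alpha> i)" if "smooth_op p" for p :: "'a elem_op"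
  proof (cases p)
    case (EvalOp f \<beta> j)
    have "snd (op_kernel p) \<alpha> i = (if \<alpha> = \<beta> \<and> i = j then \<lambda>x. (-1) ^ j * f x else (\<lambda>x. 0))"
      by (auto simp: EvalOp dirac_def fun_eq_iff)
    then show ?thesis using that EvalOp by (auto intro!: smooth_mult smooth_const)
  qed (simp add: smooth_const)
  then have "smooth (\<lambda>x. \<Sum>p\<leftarrow>ops. snd (op_kernel p) \<alpha> i x)"
    using assms by (intro smooth_sum_list) auto
  then show ?thesis by (simp add: kernel_of_def)
qed

lemma sum_snd_kernel_of:
  assumes "finite P" "(\<Union>p\<in>set ops. eval_orders p) \<subseteq> P"
  shows "(\<Sum>(\<alpha>, i)\<in>P. snd (kernel_of ops) \<alpha> i x * ((-1) ^ i * (ddx ^^ i) f \<alpha>)) =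
    (\<Sum>p\<leftarrow>ops. case p of IntegOp g \<alpha> h \<Rightarrow> 0 | EvalOp g \<alpha> i \<Rightarrow> g x * (ddx ^^ i) f \<alpha>)"
  using assms(2)
proof (induction ops)
  case Nil
  then show ?case by (simp add: kernel_of_def)
next
  case (Cons p ops)
  have "(\<Sum>(\<alpha>, i)\<in>P. snd (op_kernel p) \<alpha> i x * ((-1) ^ i * (ddx ^^ i) f \<alpha>)) =
      (case p of IntegOp g \<alpha> h \<Rightarrow> 0 | EvalOp g \<alpha> i \<Rightarrow> g x * (ddx ^^ i) f \<alpha>)"
  proof (cases p)
    case (EvalOp g \<beta> j)
    have "(\<Sum>(\<alpha>, i)\<in>P. snd (op_kernel p) \<alpha> i x * ((-1) ^ i * (ddx ^^ i) f \<alpha>)) =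
        (\<Sum>(\<alpha>, i)\<in>{(\<beta>, j)}. snd (op_kernel p) \<alpha> i x * ((-1) ^ i * (ddx ^^ i) f \<alpha>))"
      using Cons.prems EvalOp by (intro sum.mono_neutral_right assms(1)) (auto simp: dirac_def split: if_splits)
    also have "\<dots> = ((-1) ^ j * (-1) ^ j) * (g x * (ddx ^^ j) f \<beta>)"
      by (simp add: EvalOp dirac_def mult_ac)
    finally show ?thesis by (simp add: EvalOp power_mult_distrib[symmetric])
  qed (simp add: split_def)
  then show ?case
    using Cons by (simp add: snd_kernel_of distrib_right sum.distrib split_def)
qed

lemma interval_subset_Icc:
  assumes "is_interval J" "a \<in> J" "b \<in> (J :: real set)"
  shows "{a..b} \<subseteq> J"
  by (auto intro: mem_is_interval_1_I[OF assms])

text \<open>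
  Of the two indicator terms only the one for the actual order of \<open>\<alpha>\<close> and \<open>x\<close> is present, and for
  \<open>\<alpha> = x\<close> they cancel. The set \<open>J\<close> contributes nothing else, since it contains the segment from \<open>\<alpha>\<close>
  to \<open>x\<close>.
\<close>

lemma integral_IntegOp_kernel:
  fixes f g u :: "real \<Rightarrow> 'k::{real_normed_field,euclidean_space}"
  assumes J: "is_interval J" "\<alpha> \<in> J" "x \<in> J" and "smooth g" "smooth u"
  shows "set_integrable lborel J (\<lambda>\<xi>. fst (op_kernel (IntegOp f \<alpha> g)) x \<xi> * u \<xi>)"
    and "(LBINT \<xi>:J. fst (op_kernel (IntegOp f \<alpha> g)) x \<xi> * u \<xi>) = f x * integral_from \<alpha> (\<lambda>\<xi>. g \<xi> * u \<xi>) x"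
proof -
  let ?k = "\<lambda>\<xi>. fst (op_kernel (IntegOp f \<alpha> g)) x \<xi> * u \<xi>"
  have int: "set_integrable lborel {a..b} (\<lambda>\<xi>. g \<xi> * u \<xi>)" for a b
    using assms by (intro borel_integrable_atLeastAtMost' smooth_continuous_on smooth_mult)
  have "set_integrable lborel J ?k \<and> (LBINT \<xi>:J. ?k \<xi>) = f x * integral_from \<alpha> (\<lambda>\<xi>. g \<xi> * u \<xi>) x"
  proof (cases \<alpha> x rule: linorder_cases)
    case less
    have eq: "(\<lambda>\<xi>. indicator J \<xi> *\<^sub>R ?k \<xi>) = (\<lambda>\<xi>. f x * (indicator {\<alpha>..x} \<xi> *\<^sub>R (g \<xi> * u \<xi>)))"
      using less interval_subset_Icc[OF J] by (auto simp: fun_eq_iff indicator_def mult.assoc)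
    show ?thesis
      using int[of \<alpha> x] less unfolding set_integrable_def set_lebesgue_integral_def eq
      by (simp add: interval_integral_Icc set_lebesgue_integral_def del: mult_scaleR_right)
  next
    case equal
    then show ?thesis by (simp add: set_integrable_def set_lebesgue_integral_def)
  next
    case greater
    have eq: "(\<lambda>\<xi>. indicator J \<xi> *\<^sub>R ?k \<xi>) = (\<lambda>\<xi>. - f x * (indicator {x..\<alpha>} \<xi> *\<^sub>R (g \<xi> * u \<xi>)))"
      using greater interval_subset_Icc[OF J(1,3,2)] by (auto simp: fun_eq_iff indicator_def mult.assoc)
    show ?thesis
      using int[of x \<alpha>] greater unfolding set_integrable_def set_lebesgue_integral_def eq
      by (subst interval_integral_endpoints_reverse)
         (simp add: interval_integral_Icc set_lebesgue_integral_def del: mult_scaleR_right)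
  qed
  then show "set_integrable lborel J ?k" "(LBINT \<xi>:J. ?k \<xi>) = f x * integral_from \<alpha> (\<lambda>\<xi>. g \<xi> * u \<xi>) x"
    by blast+
qed

lemma integral_fst_kernel_of:
  fixes u :: "real \<Rightarrow> 'k::{real_normed_field,euclidean_space}"
  assumes J: "is_interval J" "x \<in> J" and ops: "\<forall>p\<in>set ops. smooth_op p \<and> op_point p \<in> J"
    and u: "smooth u"
  shows "set_integrable lborel J (\<lambda>\<xi>. fst (kernel_of ops) x \<xi> * u \<xi>) \<and>
    (LBINT \<xi>:J. fst (kernel_of ops) x \<xi> * u \<xi>) =
      (\<Sum>p\<leftarrow>ops. case p of IntegOp f \<alpha> g \<Rightarrow> f x * integral_from \<alpha> (\<lambda>\<xi>. g \<xi> * u \<xi>) x | EvalOp f \<alpha> i \<Rightarrow> 0)"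
  using ops
proof (induction ops)
  case Nil
  then show ?case by (simp add: kernel_of_def set_integrable_def set_lebesgue_integral_def)
next
  case (Cons p ops)
  have p: "set_integrable lborel J (\<lambda>\<xi>. fst (op_kernel p) x \<xi> * u \<xi>)"
    "(LBINT \<xi>:J. fst (op_kernel p) x \<xi> * u \<xi>) =
      (case p of IntegOp f \<alpha> g \<Rightarrow> f x * integral_from \<alpha> (\<lambda>\<xi>. g \<xi> * u \<xi>) x | EvalOp f \<alpha> i \<Rightarrow> 0)"
  proof -
    show "set_integrable lborel J (\<lambda>\<xi>. fst (op_kernel p) x \<xi> * u \<xi>)"
    proof (cases p)
      case (IntegOp f \<alpha> g)
      then show ?thesis using integral_IntegOp_kernel(1)[OF J(1) _ J(2) _ u, of \<alpha> g f] Cons.prems by simp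
    qed (simp add: set_integrable_def)
    show "(LBINT \<xi>:J. fst (op_kernel p) x \<xi> * u \<xi>) =
      (case p of IntegOp f \<alpha> g \<Rightarrow> f x * integral_from \<alpha> (\<lambda>\<xi>. g \<xi> * u \<xi>) x | EvalOp f \<alpha> i \<Rightarrow> 0)"
    proof (cases p)
      case (IntegOp f \<alpha> g)
      then show ?thesis using integral_IntegOp_kernel(2)[OF J(1) _ J(2) _ u, of \<alpha> g f] Cons.prems by simp
    qed (simp add: set_lebesgue_integral_def)
  qed
  have IH: "set_integrable lborel J (\<lambda>\<xi>. fst (kernel_of ops) x \<xi> * u \<xi>)"
    "(LBINT \<xi>:J. fst (kernel_of ops) x \<xi> * u \<xi>) =
      (\<Sum>p\<leftarrow>ops. case p of IntegOp f \<alpha> g \<Rightarrow> f x * integral_from \<alpha> (\<lambda>\<xi>. g \<xi> * u \<xi>) x | EvalOp f \<alpha> i \<Rightarrow> 0)"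
    using Cons by auto
  have eq: "(\<lambda>\<xi>. fst (kernel_of (p # ops)) x \<xi> * u \<xi>) =
      (\<lambda>\<xi>. fst (op_kernel p) x \<xi> * u \<xi> + fst (kernel_of ops) x \<xi> * u \<xi>)"
    by (simp add: kernel_of_def distrib_right)
  show ?case
    unfolding eq using p(1) IH(1) by (simp add: set_integral_add p(2) IH(2))
qed

text \<open>
  The sign \<open>(-1)\<^sup>i\<close> in the kernel of an evaluation of order \<open>i\<close> cancels the sign in the action of the
  \<open>i\<close>-th derivative of a Dirac distribution. With \<open>J = UNIV\<close> this applies to operators with arbitrary
  points.
\<close>

lemma op_sum_eq_kernel_action:
  fixes u :: "real \<Rightarrow> 'k::{real_normed_field,euclidean_space}"
  assumes J: "is_interval J" "x \<in> J" and ops: "\<forall>p\<in>set ops. smooth_op p \<and> op_point p \<in> J"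
    and u: "smooth u"
  shows "op_sum ops u x = (LBINT \<xi>:J. fst (kernel_of ops) x \<xi> * u \<xi>) +
    (\<Sum>(\<alpha>, i)\<in>(\<Union>p\<in>set ops. eval_orders p). snd (kernel_of ops) \<alpha> i x * ((-1) ^ i * (ddx ^^ i) u \<alpha>))"
proof -
  have "op_sum ops u x =
      (\<Sum>p\<leftarrow>ops. case p of IntegOp f \<alpha> g \<Rightarrow> f x * integral_from \<alpha> (\<lambda>\<xi>. g \<xi> * u \<xi>) x | EvalOp f \<alpha> i \<Rightarrow> 0)
      + (\<Sum>p\<leftarrow>ops. case p of IntegOp g \<alpha> h \<Rightarrow> 0 | EvalOp g \<alpha> i \<Rightarrow> g x * (ddx ^^ i) u \<alpha>)"
    unfolding op_sum_def sum_list_addf[symmetric]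
    by (intro arg_cong[where f=sum_list] map_cong refl) (auto split: elem_op.split)
  then show ?thesis
    using integral_fst_kernel_of[OF assms] sum_snd_kernel_of[OF finite_eval_orders order_refl, of ops x u]
    by simp
qed

lemma kernel_integral_kernel_of:
  fixes u :: "real \<Rightarrow> 'k::{real_normed_field,euclidean_space}"
  assumes J: "is_interval J" "x \<in> J" and ops: "\<forall>p\<in>set ops. smooth_op p \<and> op_point p \<in> J"
    and u: "smooth u"
  shows "kernel_integral J (kernel_of ops) u x = op_sum ops u x"
proof -
  let ?P = "\<Union>p\<in>set ops. eval_orders p"
  have "(\<Sum>(\<alpha>, i)\<in>{(\<alpha>, i). \<alpha> \<in> J \<and> snd (kernel_of ops) \<alpha> i x \<noteq> 0}.
      snd (kernel_of ops) \<alpha> i x * ((-1) ^ i * (ddx ^^ i) u \<alpha>)) =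
    (\<Sum>(\<alpha>, i)\<in>?P. snd (kernel_of ops) \<alpha> i x * ((-1) ^ i * (ddx ^^ i) u \<alpha>))"
  proof (intro sum.mono_neutral_left[OF finite_eval_orders] ballI)
    show "{(\<alpha>, i). \<alpha> \<in> J \<and> snd (kernel_of ops) \<alpha> i x \<noteq> 0} \<subseteq> ?P"
      using snd_kernel_of_nonzero by fast
    fix q assume q: "q \<in> ?P - {(\<alpha>, i). \<alpha> \<in> J \<and> snd (kernel_of ops) \<alpha> i x \<noteq> 0}"
    obtain \<alpha> i where \<alpha>: "q = (\<alpha>, i)" by (cases q)
    then have "\<alpha> \<in> J" using q ops eval_orders_point by blast
    then show "(case q of (\<alpha>, i) \<Rightarrow> snd (kernel_of ops) \<alpha> i x * ((-1) ^ i * (ddx ^^ i) u \<alpha>)) = 0"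
      using q \<alpha> by simp
  qed
  then show ?thesis
    unfolding op_sum_eq_kernel_action[OF assms] kernel_integral_def by simp
qed

section \<open>The branches of a kernel\<close>

text \<open>
  For \<open>x < \<xi>\<close> an integral based at \<open>\<alpha>\<close> contributes to the kernel iff \<open>\<xi> \<le> \<alpha>\<close>, for \<open>\<xi> < x\<close> iff
  \<open>\<alpha> \<le> \<xi>\<close>. The branches replace \<open>\<xi>\<close> in these conditions by a fixed threshold \<open>t\<close>. This makes them
  continuous in \<open>(x, \<xi>)\<close>, and they agree with the kernel as long as no point lies between \<open>t\<close> and \<open>\<xi>\<close>.
\<close>

definition left_branch :: "real \<Rightarrow> 'k::{real_normed_field,euclidean_space} elem_op list \<Rightarrow> real \<Rightarrow> real \<Rightarrow> 'k" where
  "left_branch t ops x \<xi> =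
     (\<Sum>p\<leftarrow>ops. case p of IntegOp f \<alpha> g \<Rightarrow> - (f x * g \<xi> * of_bool (t \<le> \<alpha>)) | EvalOp f \<alpha> i \<Rightarrow> 0)"

definition right_branch :: "real \<Rightarrow> 'k::{real_normed_field,euclidean_space} elem_op list \<Rightarrow> real \<Rightarrow> real \<Rightarrow> 'k" where
  "right_branch t ops x \<xi> =
     (\<Sum>p\<leftarrow>ops. case p of IntegOp f \<alpha> g \<Rightarrow> f x * g \<xi> * of_bool (\<alpha> \<le> t) | EvalOp f \<alpha> i \<Rightarrow> 0)"

lemma fst_kernel_of_left:
  assumes "x < \<xi>" "\<And>p. p \<in> set ops \<Longrightarrow> \<xi> \<le> op_point p \<longleftrightarrow> t \<le> op_point p"
  shows "fst (kernel_of ops) x \<xi> = left_branch t ops x \<xi>"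
proof -
  have "fst (op_kernel p) x \<xi> =
      (case p of IntegOp f \<alpha> g \<Rightarrow> - (f x * g \<xi> * of_bool (t \<le> \<alpha>)) | EvalOp f \<alpha> i \<Rightarrow> 0)"
    if "p \<in> set ops" for p
    using assms(1) assms(2)[OF that] by (cases p) auto
  then show ?thesis
    unfolding fst_kernel_of left_branch_def by (intro arg_cong[where f=sum_list] map_cong) auto
qed

lemma fst_kernel_of_right:
  assumes "\<xi> < x" "\<And>p. p \<in> set ops \<Longrightarrow> op_point p \<le> \<xi> \<longleftrightarrow> op_point p \<le> t"
  shows "fst (kernel_of ops) x \<xi> = right_branch t ops x \<xi>"
proof -
  have "fst (op_kernel p) x \<xi> =
      (case p of IntegOp f \<alpha> g \<Rightarrow> f x * g \<xi> * of_bool (\<alpha> \<le> t) | EvalOp f \<alpha> i \<Rightarrow> 0)"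
    if "p \<in> set ops" for p
    using assms(1) assms(2)[OF that] by (cases p) auto
  then show ?thesis
    unfolding fst_kernel_of right_branch_def by (intro arg_cong[where f=sum_list] map_cong) auto
qed

lemma left_branch_eq_0: "(\<And>p. p \<in> set ops \<Longrightarrow> op_point p < t) \<Longrightarrow> left_branch t ops x \<xi> = 0"
  unfolding left_branch_def
proof (induction ops)
  case (Cons p ops)
  have "(case p of IntegOp f \<alpha> g \<Rightarrow> - (f x * g \<xi> * of_bool (t \<le> \<alpha>)) | EvalOp f \<alpha> i \<Rightarrow> 0) = 0"
    using Cons.prems[of p] by (cases p) auto
  then show ?case using Cons by simp
qed simp

lemma right_branch_eq_0: "(\<And>p. p \<in> set ops \<Longrightarrow> t < op_point p) \<Longrightarrow> right_branch t ops x \<xi> = 0"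
  unfolding right_branch_def
proof (induction ops)
  case (Cons p ops)
  have "(case p of IntegOp f \<alpha> g \<Rightarrow> f x * g \<xi> * of_bool (\<alpha> \<le> t) | EvalOp f \<alpha> i \<Rightarrow> 0) = 0"
    using Cons.prems[of p] by (cases p) auto
  then show ?case using Cons by simp
qed simp

lemma continuous_on_smooth_fst:
  "smooth f \<Longrightarrow> continuous_on S (\<lambda>z :: real \<times> real. f (fst z))"
  by (rule continuous_on_compose2[OF smooth_continuous_on[of f UNIV]]) (auto intro: continuous_intros)

lemma continuous_on_smooth_snd:
  "smooth f \<Longrightarrow> continuous_on S (\<lambda>z :: real \<times> real. f (snd z))"
  by (rule continuous_on_compose2[OF smooth_continuous_on[of f UNIV]]) (auto intro: continuous_intros)

lemma continuous_on_branches: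
  assumes "\<forall>p\<in>set ops. smooth_op p"
  shows "continuous_on S (\<lambda>(x, \<xi>). left_branch t ops x \<xi>)"
    and "continuous_on S (\<lambda>(x, \<xi>). right_branch t ops x \<xi>)"
proof -
  show "continuous_on S (\<lambda>(x, \<xi>). left_branch t ops x \<xi>)"
    using assms unfolding left_branch_def split_def
  proof (induction ops)
    case (Cons p ops)
    then show ?case
      by (cases p) (auto intro!: continuous_on_diff continuous_on_add continuous_intros
          continuous_on_smooth_fst continuous_on_smooth_snd)
  qed simp
  show "continuous_on S (\<lambda>(x, \<xi>). right_branch t ops x \<xi>)"
    using assms unfolding right_branch_def split_def
  proof (induction ops)
    case (Cons p ops)
    then show ?case
      by (cases p) (auto intro!: continuous_on_add continuous_intros
          continuous_on_smooth_fst continuous_on_smooth_snd)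
  qed simp
qed

text \<open>
  While \<open>\<xi>\<close> stays between two consecutive points, the right neighbour serves as the threshold of the
  left branch and the left neighbour as that of the right branch.
\<close>

lemma case_branches_kernel_of:
  assumes "sorted_wrt (<) \<alpha>s" and ops: "\<forall>p\<in>set ops. smooth_op p \<and> op_point p \<in> set \<alpha>s"
  shows "case_branches \<alpha>s J (fst (kernel_of ops))"
  unfolding case_branches_def
proof (rule exI[of _ "\<lambda>i. left_branch (\<alpha>s ! Suc i) ops"], rule exI[of _ "\<lambda>i. right_branch (\<alpha>s ! i) ops"],
    intro allI impI conjI ballI)
  fix i assume i: "Suc i < length \<alpha>s"
  show "continuous_on (J \<times> J) (\<lambda>(x, \<xi>). left_branch (\<alpha>s ! Suc i) ops x \<xi>)"
    "continuous_on (J \<times> J) (\<lambda>(x, \<xi>). right_branch (\<alpha>s ! i) ops x \<xi>)"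
    using ops by (auto intro!: continuous_on_branches)
  fix x \<xi> assume \<xi>: "\<xi> \<in> {\<alpha>s ! i<..<\<alpha>s ! Suc i}"
  have gap: "\<alpha> \<le> \<alpha>s ! i \<or> \<alpha>s ! Suc i \<le> \<alpha>" if \<alpha>: "\<alpha> \<in> set \<alpha>s" for \<alpha>
  proof -
    obtain k where k: "k < length \<alpha>s" "\<alpha> = \<alpha>s ! k" using \<alpha> by (auto simp: in_set_conv_nth)
    have mono: "\<alpha>s ! j \<le> \<alpha>s ! l" if "j \<le> l" "l < length \<alpha>s" for j l
      using sorted_wrt_nth_less[OF assms(1), of j l] that by (cases "j = l") auto
    show ?thesis using mono[of k i] mono[of "Suc i" k] k i by (cases "k \<le> i") auto
  qed
  show "fst (kernel_of ops) x \<xi> = left_branch (\<alpha>s ! Suc i) ops x \<xi>" if "x < \<xi>"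
    using that by (rule fst_kernel_of_left) (use gap ops \<xi> in fastforce)
  show "fst (kernel_of ops) x \<xi> = right_branch (\<alpha>s ! i) ops x \<xi>" if "\<xi> < x"
    using that by (rule fst_kernel_of_right) (use gap ops \<xi> in fastforce)
qed

text \<open>
  To the left of all points every integral contributes if \<open>x < \<xi>\<close>, and none if \<open>\<xi> < x\<close>; to the right it
  is the other way round.
\<close>

lemma outer_branches_kernel_of:
  assumes "sorted_wrt (<) \<alpha>s" and ops: "\<forall>p\<in>set ops. smooth_op p \<and> op_point p \<in> set \<alpha>s"
  shows "outer_branches \<alpha>s J (fst (kernel_of ops))"
proof -
  have sorted: "sorted \<alpha>s" using assms(1) by (simp add: strict_sorted_iff)
  have ends: "hd \<alpha>s \<le> \<alpha>" "\<alpha> \<le> last \<alpha>s" if \<alpha>: "\<alpha> \<in> set \<alpha>s" for \<alpha>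
  proof -
    have "\<alpha>s \<noteq> []" using that by auto
    obtain k where k: "k < length \<alpha>s" "\<alpha> = \<alpha>s ! k" using \<alpha> by (auto simp: in_set_conv_nth)
    then show "hd \<alpha>s \<le> \<alpha>" "\<alpha> \<le> last \<alpha>s"
      using sorted_nth_mono[OF sorted, of 0 k] sorted_nth_mono[OF sorted, of k "length \<alpha>s - 1"] \<open>\<alpha>s \<noteq> []\<close>
      by (auto simp: hd_conv_nth last_conv_nth)
  qed
  have pts: "hd \<alpha>s \<le> op_point p" "op_point p \<le> last \<alpha>s" if "p \<in> set ops" for p
    using that ops ends by blast+
  show ?thesis
    unfolding outer_branches_def
  proof (rule exI[of _ "left_branch (hd \<alpha>s) ops"], rule exI[of _ "right_branch (last \<alpha>s) ops"],
      intro conjI ballI impI)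
    show "continuous_on (J \<times> J) (\<lambda>(x, \<xi>). left_branch (hd \<alpha>s) ops x \<xi>)"
      "continuous_on (J \<times> J) (\<lambda>(x, \<xi>). right_branch (last \<alpha>s) ops x \<xi>)"
      using ops by (auto intro!: continuous_on_branches)
    fix x \<xi>
    show "fst (kernel_of ops) x \<xi> = left_branch (hd \<alpha>s) ops x \<xi>" if "\<xi> < hd \<alpha>s" "x < \<xi>"
      using that(2) by (rule fst_kernel_of_left) (use that pts in force)
    show "fst (kernel_of ops) x \<xi> = right_branch (last \<alpha>s) ops x \<xi>" if "last \<alpha>s < \<xi>" "\<xi> < x"
      using that(2) by (rule fst_kernel_of_right) (use that pts in force)
    show "fst (kernel_of ops) x \<xi> = 0" if "\<xi> < hd \<alpha>s" "\<xi> < x"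
    proof -
      have "fst (kernel_of ops) x \<xi> = right_branch \<xi> ops x \<xi>"
        using that(2) by (rule fst_kernel_of_right) simp
      also have "\<dots> = 0" by (rule right_branch_eq_0) (use that pts in force)
      finally show ?thesis .
    qed
    show "fst (kernel_of ops) x \<xi> = 0" if "last \<alpha>s < \<xi>" "x < \<xi>"
    proof -
      have "fst (kernel_of ops) x \<xi> = left_branch \<xi> ops x \<xi>"
        using that(2) by (rule fst_kernel_of_left) simp
      also have "\<dots> = 0" by (rule left_branch_eq_0) (use that pts in force)
      finally show ?thesis .
    qed
  qed
qed

text \<open>
  The coefficients are read off from the kernel itself. As the points are distinct, at most one summand
  of the double sum is nonzero for a given point and order.
\<close>

lemma dirac_combination_kernel_of:
  assumes "sorted_wrt (<) \<alpha>s" and ops: "\<forall>p\<in>set ops. smooth_op p \<and> op_point p \<in> set \<alpha>s"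
  shows "dirac_combination \<alpha>s (snd (kernel_of ops))"
proof -
  let ?P = "\<Union>p\<in>set ops. eval_orders p"
  have "finite (snd ` ?P)" using finite_eval_orders by blast
  then obtain N where N: "\<forall>j\<in>snd ` ?P. j < N"
    using finite_nat_set_iff_bounded by blast
  let ?d = "snd (kernel_of ops)"
  have dist: "distinct \<alpha>s" using assms(1) by (simp add: strict_sorted_iff)
  have "?d \<beta> k x = (\<Sum>i<length \<alpha>s. \<Sum>j<N. dirac (?d (\<alpha>s ! i) j) (\<alpha>s ! i) j \<beta> k x)" for \<beta> k x
  proof (cases "\<beta> \<in> set \<alpha>s \<and> k < N")
    case True
    then obtain l where l: "l < length \<alpha>s" "\<beta> = \<alpha>s ! l" by (auto simp: in_set_conv_nth)
    have "(\<Sum>i<length \<alpha>s. \<Sum>j<N. dirac (?d (\<alpha>s ! i) j) (\<alpha>s ! i) j \<beta> k x) =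
        (\<Sum>i<length \<alpha>s. if i = l then ?d \<beta> k x else 0)"
    proof (intro sum.cong refl)
      fix i assume "i \<in> {..<length \<alpha>s}"
      then have "\<beta> = \<alpha>s ! i \<longleftrightarrow> i = l"
        using l dist by (auto simp: nth_eq_iff_index_eq)
      then show "(\<Sum>j<N. dirac (?d (\<alpha>s ! i) j) (\<alpha>s ! i) j \<beta> k x) = (if i = l then ?d \<beta> k x else 0)"
        using True l(2) by (simp add: dirac_def)
    qed
    then show ?thesis using l by simp
  next
    case False
    have "?d \<beta> k x = 0"
    proof (rule ccontr)
      assume "?d \<beta> k x \<noteq> 0"
      then have P: "(\<beta>, k) \<in> ?P" by (rule snd_kernel_of_nonzero)
      then have "k \<in> snd ` ?P" by force
      then have "k < N" using N by blast
      moreover have "\<beta> \<in> set \<alpha>s" using P ops eval_orders_point by blast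
      ultimately show False using False by blast
    qed
    moreover have "dirac (?d (\<alpha>s ! i) j) (\<alpha>s ! i) j \<beta> k x = 0" if "i < length \<alpha>s" "j < N" for i j
      using False that by (auto simp: dirac_def)
    ultimately show ?thesis by simp
  qed
  then show ?thesis
    unfolding dirac_combination_def
    using ops by (intro exI[of _ N] exI[of _ "\<lambda>i. ?d (\<alpha>s ! i)"])
      (auto simp: fun_eq_iff intro!: smooth_snd_kernel_of)
qed

section \<open>Uniqueness of kernels\<close>

text \<open>
  Taylor's formula for a product with \<open>(x - \<alpha>)\<^sup>m\<close>. It shows that polynomials can serve as test
  functions: they can be made to vanish to any order at finitely many points.
\<close>

lemma ddx_funpow_power_mult:
  fixes g :: "real \<Rightarrow> 'k::real_normed_field"
  assumes "smooth g" "i \<le> m"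
  shows "(ddx ^^ i) (\<lambda>x. (of_real x - of_real \<alpha>) ^ m * g x) \<alpha> = (if i = m then fact m * g \<alpha> else 0)"
  using assms
proof (induction i arbitrary: m g)
  case 0
  then show ?case by (cases m) auto
next
  case (Suc i)
  then obtain m' where m: "m = Suc m'" by (cases m) auto
  define g1 where "g1 x = of_nat (Suc m') * g x + (of_real x - of_real \<alpha>) * ddx g x" for x
  have sm: "smooth (\<lambda>x. (of_real x - of_real \<alpha>) :: 'k)"
    by (intro smooth_intros)
  have "smooth g1"
    unfolding g1_def by (intro smooth_add smooth_mult smooth_const sm smooth_ddx Suc.prems)
  have "ddx (\<lambda>x. (of_real x - of_real \<alpha>) ^ m * g x) = (\<lambda>x. (of_real x - of_real \<alpha>) ^ m' * g1 x)"
  proof (rule ddx_eqI)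
    fix x
    have "((\<lambda>x. of_real ((x - \<alpha>) ^ m)) has_vector_derivative
        (of_real (real m * (x - \<alpha>) ^ (m - 1)) :: 'k)) (at x)"
      by (rule has_vector_derivative_of_real) (auto intro!: derivative_eq_intros)
    then have "((\<lambda>x. (of_real x - of_real \<alpha>) ^ m) has_vector_derivative
        (of_nat m * (of_real x - of_real \<alpha> :: 'k) ^ (m - 1))) (at x)"
      by simp
    from has_vector_derivative_mult[OF this smooth_has_vector_derivative[OF Suc.prems(1), of x]]
    show "((\<lambda>x. (of_real x - of_real \<alpha>) ^ m * g x) has_vector_derivative
        (of_real x - of_real \<alpha>) ^ m' * g1 x) (at x)"
      by (simp add: m g1_def algebra_simps)
  qed
  then have "(ddx ^^ Suc i) (\<lambda>x. (of_real x - of_real \<alpha>) ^ m * g x) \<alpha> =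
      (ddx ^^ i) (\<lambda>x. (of_real x - of_real \<alpha>) ^ m' * g1 x) \<alpha>"
    by (simp add: funpow_Suc_right del: funpow.simps)
  also have "\<dots> = (if i = m' then fact m' * g1 \<alpha> else 0)"
    using Suc.IH[OF \<open>smooth g1\<close>, of m'] Suc.prems(2) m by simp
  also have "\<dots> = (if Suc i = m then fact m * g \<alpha> else 0)"
    by (simp add: m g1_def algebra_simps)
  finally show ?case .
qed

lemma smooth_root_product:
  "smooth (\<lambda>x. \<Prod>\<beta>\<in>B. (of_real x - of_real \<beta> :: 'k::real_normed_field) ^ N)"
  by (intro smooth_prod smooth_power smooth_diff smooth_of_real smooth_const)

lemma ddx_funpow_root_product:
  fixes q :: "real \<Rightarrow> 'k::real_normed_field"
  assumes "finite B" "\<beta> \<in> B" "i < N" "smooth q"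
  shows "(ddx ^^ i) (\<lambda>x. (\<Prod>\<beta>\<in>B. (of_real x - of_real \<beta>) ^ N) * q x) \<beta> = 0"
proof -
  define g where "g x = (\<Prod>\<beta>\<in>B - {\<beta>}. (of_real x - of_real \<beta>) ^ N) * q x" for x
  have "smooth g"
    unfolding g_def by (intro smooth_mult smooth_root_product assms)
  have "(\<lambda>x. (\<Prod>\<beta>\<in>B. (of_real x - of_real \<beta>) ^ N) * q x) = (\<lambda>x. (of_real x - of_real \<beta>) ^ N * g x)"
    unfolding prod.remove[OF assms(1,2)] g_def mult.assoc ..
  then show ?thesis
    using ddx_funpow_power_mult[OF \<open>smooth g\<close>, of i N \<beta>] assms(3) by simp
qed

text \<open>
  If \<open>m\<close> is the largest order that occurs at \<open>\<alpha>\<close>, then \<open>(x - \<alpha>)\<^sup>m\<close> times a high power of \<open>x - \<beta>\<close> for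
  each of the other points \<open>\<beta>\<close> is a test function on which this term acts alone.
\<close>

lemma dirac_derivatives_independent:
  fixes e :: "real \<Rightarrow> nat \<Rightarrow> 'k::real_normed_field"
  assumes P: "finite P"
    and null: "\<And>f. smooth f \<Longrightarrow> (\<Sum>(\<alpha>, i)\<in>P. e \<alpha> i * (ddx ^^ i) f \<alpha>) = 0"
    and "(\<alpha>, i) \<in> P"
  shows "e \<alpha> i = 0"
proof (rule ccontr)
  assume "e \<alpha> i \<noteq> 0"
  define I where "I = {i. (\<alpha>, i) \<in> P \<and> e \<alpha> i \<noteq> 0}"
  have "I \<subseteq> snd ` P" by (force simp: I_def)
  then have "finite I" using P finite_surj by blast
  have "I \<noteq> {}" using assms(3) \<open>e \<alpha> i \<noteq> 0\<close> by (auto simp: I_def)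
  define m where "m = Max I"
  have m: "(\<alpha>, m) \<in> P" "e \<alpha> m \<noteq> 0" and m_max: "\<And>j. (\<alpha>, j) \<in> P \<Longrightarrow> m < j \<Longrightarrow> e \<alpha> j = 0"
    using Max_in[OF \<open>finite I\<close> \<open>I \<noteq> {}\<close>] Max_ge[OF \<open>finite I\<close>] by (force simp: m_def I_def)+
  obtain N where N: "\<forall>j\<in>snd ` P. j < N"
    using P finite_nat_set_iff_bounded by blast
  define B where "B = fst ` P - {\<alpha>}"
  have "finite B" using P by (simp add: B_def)
  define r where "r x = (\<Prod>\<beta>\<in>B. (of_real x - of_real \<beta> :: 'k) ^ N)" for x
  have smr: "smooth r" unfolding r_def by (rule smooth_root_product)
  have r\<alpha>: "r \<alpha> \<noteq> 0" using \<open>finite B\<close> by (auto simp: r_def B_def)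
  define f where "f x = r x * (of_real x - of_real \<alpha>) ^ m" for x
  have smp: "smooth (\<lambda>x. (of_real x - of_real \<alpha> :: 'k) ^ m)"
    by (intro smooth_power smooth_diff smooth_of_real smooth_const)
  have smf: "smooth f" unfolding f_def by (intro smooth_mult smr smp)
  have f_comm: "f = (\<lambda>x. (of_real x - of_real \<alpha>) ^ m * r x)" by (simp add: f_def fun_eq_iff mult.commute)
  have "e \<beta> j * (ddx ^^ j) f \<beta> = 0" if "(\<beta>, j) \<in> P" "(\<beta>, j) \<noteq> (\<alpha>, m)" for \<beta> j
  proof (cases "\<beta> = \<alpha>")
    case True
    then have "j < m \<or> m < j" using that(2) by auto
    then show ?thesis
    proof
      assume "j < m"
      then show ?thesis
        unfolding f_comm using ddx_funpow_power_mult[OF smr, of j m \<alpha>] True by simp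
    next
      assume "m < j"
      then show ?thesis using m_max that(1) True by simp
    qed
  next
    case False
    then have "\<beta> \<in> B" using that(1) by (force simp: B_def)
    moreover have "j < N" using N that(1) by force
    ultimately show ?thesis
      unfolding f_def r_def using ddx_funpow_root_product[OF \<open>finite B\<close> _ _ smp, of \<beta> j N] by simp
  qed
  then have "(\<Sum>(\<beta>, j)\<in>P. e \<beta> j * (ddx ^^ j) f \<beta>) = (\<Sum>(\<beta>, j)\<in>{(\<alpha>, m)}. e \<beta> j * (ddx ^^ j) f \<beta>)"
    using m(1) by (intro sum.mono_neutral_right P) (blast | fastforce)+
  also have "\<dots> = e \<alpha> m * (fact m * r \<alpha>)"
    unfolding f_comm using ddx_funpow_power_mult[OF smr, of m m \<alpha>] by simp
  finally show False using null[OF smf] m(2) r\<alpha> by simp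
qed

lemma integrable_mult_continuous:
  fixes h \<phi> :: "real \<Rightarrow> 'k::{real_normed_field,euclidean_space}"
  assumes "integrable lborel h" and supp: "\<And>\<xi>. \<xi> \<notin> {-R..R} \<Longrightarrow> h \<xi> = 0" and \<phi>: "continuous_on UNIV \<phi>"
  shows "integrable lborel (\<lambda>\<xi>. h \<xi> * \<phi> \<xi>)"
proof -
  have "compact (\<phi> ` {-R..R})"
    using \<phi> by (intro compact_continuous_image) (auto intro: continuous_on_subset)
  then have "\<exists>M. \<forall>\<xi>\<in>{-R..R}. norm (\<phi> \<xi>) \<le> M"
    by (auto dest!: compact_imp_bounded simp: bounded_iff)
  then obtain M where M: "\<And>\<xi>. \<xi> \<in> {-R..R} \<Longrightarrow> norm (\<phi> \<xi>) \<le> M" by blast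
  show ?thesis
  proof (rule Bochner_Integration.integrable_bound[of _ "\<lambda>\<xi>. M *\<^sub>R norm (h \<xi>)"])
    show "integrable lborel (\<lambda>\<xi>. M *\<^sub>R norm (h \<xi>))"
      using assms(1) by (intro integrable_scaleR_right integrable_norm)
    have "\<phi> \<in> borel_measurable borel" using \<phi> by (rule borel_measurable_continuous_onI)
    then show "(\<lambda>\<xi>. h \<xi> * \<phi> \<xi>) \<in> borel_measurable lborel"
      using borel_measurable_integrable[OF assms(1)] by simp
    show "AE \<xi> in lborel. norm (h \<xi> * \<phi> \<xi>) \<le> norm (M *\<^sub>R norm (h \<xi>))"
    proof (rule AE_I2)
      fix \<xi>
      show "norm (h \<xi> * \<phi> \<xi>) \<le> norm (M *\<^sub>R norm (h \<xi>))"
      proof (cases "\<xi> \<in> {-R..R}")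
        case True
        have "norm (\<phi> \<xi>) \<le> \<bar>M\<bar>" using M[OF True] by linarith
        then have "norm (h \<xi>) * norm (\<phi> \<xi>) \<le> norm (h \<xi>) * \<bar>M\<bar>" by (intro mult_left_mono) auto
        then show ?thesis by (simp add: norm_mult abs_mult mult.commute)
      qed (simp add: supp)
    qed
  qed
qed

text \<open>
  By the Weierstrass approximation theorem on \<open>{-R..R}\<close> a function orthogonal to all polynomials is
  orthogonal to all continuous functions. If it were nonzero at a point of continuity, a tent function
  supported near this point would contradict that.
\<close>

lemma polynomial_moments_zero:
  fixes h :: "real \<Rightarrow> 'k::{real_normed_field,euclidean_space}"
  assumes int: "integrable lborel h" and supp: "\<And>\<xi>. \<xi> \<notin> {-R..R} \<Longrightarrow> h \<xi> = 0"
    and null: "\<And>q. real_polynomial_function q \<Longrightarrow> (LBINT \<xi>. h \<xi> * of_real (q \<xi>)) = 0"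
    and cont: "isCont h \<xi>0"
  shows "h \<xi>0 = 0"
proof (rule ccontr)
  have cont_of_real: "continuous_on UNIV (\<lambda>\<xi>. of_real (\<phi> \<xi>) :: 'k)" if "continuous_on UNIV \<phi>" for \<phi> :: "real \<Rightarrow> real"
    using that by (rule continuous_on_of_real)
  have null_cont: "(LBINT \<xi>. h \<xi> * of_real (\<phi> \<xi>)) = 0" if \<phi>: "continuous_on UNIV \<phi>" for \<phi> :: "real \<Rightarrow> real"
  proof -
    define H where "H = (LBINT \<xi>. norm (h \<xi>))"
    have "norm (LBINT \<xi>. h \<xi> * of_real (\<phi> \<xi>)) \<le> e * H" if "e > 0" for e
    proof -
      obtain q where q: "real_polynomial_function q" "\<And>\<xi>. \<xi> \<in> {-R..R} \<Longrightarrow> \<bar>\<phi> \<xi> - q \<xi>\<bar> < e"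
        by (rule Stone_Weierstrass_real_polynomial_function[OF compact_Icc[of "-R" R]
              continuous_on_subset[OF \<phi> subset_UNIV] \<open>e > 0\<close>]) (rule that)
      have q_cont: "continuous_on UNIV q"
        using q(1) by (intro continuous_at_imp_continuous_on ballI continuous_real_polymonial_function)
      have "(LBINT \<xi>. h \<xi> * of_real (\<phi> \<xi>)) = (LBINT \<xi>. h \<xi> * of_real (\<phi> \<xi>)) - (LBINT \<xi>. h \<xi> * of_real (q \<xi>))"
        using null[OF q(1)] by simp
      also have "\<dots> = (LBINT \<xi>. h \<xi> * of_real (\<phi> \<xi>) - h \<xi> * of_real (q \<xi>))"
        by (rule Bochner_Integration.integral_diff[symmetric])
           (intro integrable_mult_continuous[OF int supp] cont_of_real \<phi> q_cont, assumption)+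
      also have "norm \<dots> \<le> (LBINT \<xi>. e * norm (h \<xi>))"
      proof (rule Bochner_Integration.integral_norm_bound_integral)
        show "integrable lborel (\<lambda>\<xi>. h \<xi> * of_real (\<phi> \<xi>) - h \<xi> * of_real (q \<xi>))"
          by (intro Bochner_Integration.integrable_diff integrable_mult_continuous[OF int supp] cont_of_real \<phi> q_cont)
        show "integrable lborel (\<lambda>\<xi>. e * norm (h \<xi>))"
          using int by simp
        fix \<xi>
        show "norm (h \<xi> * of_real (\<phi> \<xi>) - h \<xi> * of_real (q \<xi>)) \<le> e * norm (h \<xi>)"
        proof (cases "\<xi> \<in> {-R..R}")
          case True
          have "norm (h \<xi> * of_real (\<phi> \<xi>) - h \<xi> * of_real (q \<xi>)) = norm (h \<xi>) * \<bar>\<phi> \<xi> - q \<xi>\<bar>"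
            by (simp flip: right_diff_distrib of_real_diff add: norm_mult)
          also have "\<dots> \<le> norm (h \<xi>) * e"
            using q(2)[OF True] by (intro mult_left_mono) auto
          finally show ?thesis by (simp add: mult.commute)
        qed (simp add: supp)
      qed
      finally show ?thesis by (simp add: H_def)
    qed
    note bound = this
    have "H \<ge> 0" by (simp add: H_def)
    have "norm (LBINT \<xi>. h \<xi> * of_real (\<phi> \<xi>)) \<le> 0 + d" if "d > 0" for d
    proof -
      have "norm (LBINT \<xi>. h \<xi> * of_real (\<phi> \<xi>)) \<le> d / (H + 1) * H"
        using that \<open>H \<ge> 0\<close> by (intro bound) simp
      also have "\<dots> \<le> d / (H + 1) * (H + 1)"
        using that \<open>H \<ge> 0\<close> by (intro mult_left_mono) simp_all
      also have "\<dots> = d" using \<open>H \<ge> 0\<close> by simp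
      finally show ?thesis by simp
    qed
    then have "norm (LBINT \<xi>. h \<xi> * of_real (\<phi> \<xi>)) \<le> 0"
      by (rule field_le_epsilon)
    then show ?thesis by simp
  qed
  assume nz: "h \<xi>0 \<noteq> 0"
  \<comment> \<open>the tent integrates \<open>h\<close> to zero, but \<open>h\<close> differs from \<open>h \<xi>0\<close> by at most half its norm there\<close>
  define c where "c = norm (h \<xi>0) / 2"
  have "c > 0" using nz by (simp add: c_def)
  obtain \<delta> where \<delta>: "\<delta> > 0" "\<And>\<xi>. \<bar>\<xi> - \<xi>0\<bar> < \<delta> \<Longrightarrow> norm (h \<xi> - h \<xi>0) < c"
    using cont \<open>c > 0\<close> unfolding continuous_at_eps_delta by (auto simp: dist_norm)
  define \<phi> where "\<phi> \<xi> = max 0 (\<delta> - \<bar>\<xi> - \<xi>0\<bar>)" for \<xi>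
  have \<phi>_cont: "continuous_on UNIV \<phi>" unfolding \<phi>_def by (intro continuous_intros)
  have \<phi>_int: "integrable lborel \<phi>"
  proof -
    have "set_integrable lborel {\<xi>0 - \<delta>..\<xi>0 + \<delta>} \<phi>"
      by (intro borel_integrable_atLeastAtMost' continuous_on_subset[OF \<phi>_cont]) auto
    moreover have "(\<lambda>\<xi>. indicator {\<xi>0 - \<delta>..\<xi>0 + \<delta>} \<xi> *\<^sub>R \<phi> \<xi>) = \<phi>"
      by (auto simp: fun_eq_iff \<phi>_def indicator_def)
    ultimately show ?thesis by (simp add: set_integrable_def)
  qed
  have "\<delta> * (\<delta> / 2) = (LBINT \<xi>. indicator {\<xi>0 - \<delta>/2..\<xi>0 + \<delta>/2} \<xi> * (\<delta> / 2))"
    using \<delta>(1) by simp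
  also have "\<dots> \<le> (LBINT \<xi>. \<phi> \<xi>)"
  proof (rule integral_mono)
    show "integrable lborel (\<lambda>\<xi>. indicat_real {\<xi>0 - \<delta>/2..\<xi>0 + \<delta>/2} \<xi> * (\<delta> / 2))"
      by (intro integrable_mult_left integrable_real_indicator) (auto simp: emeasure_lborel_Icc_eq)
    show "indicat_real {\<xi>0 - \<delta>/2..\<xi>0 + \<delta>/2} \<xi> * (\<delta> / 2) \<le> \<phi> \<xi>" for \<xi>
      by (auto simp: indicator_def \<phi>_def abs_if field_simps)
  qed (rule \<phi>_int)
  finally have "\<delta> * (\<delta> / 2) \<le> (LBINT \<xi>. \<phi> \<xi>)" .
  moreover have "\<delta> * (\<delta> / 2) > 0" using \<delta>(1) by simp
  ultimately have pos: "(LBINT \<xi>. \<phi> \<xi>) > 0" by linarith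
  have int1: "integrable lborel (\<lambda>\<xi>. h \<xi> * of_real (\<phi> \<xi>))"
    by (intro integrable_mult_continuous[OF int supp] cont_of_real \<phi>_cont)
  have int2: "integrable lborel (\<lambda>\<xi>. h \<xi>0 * of_real (\<phi> \<xi>))"
    using \<phi>_int by simp
  have "h \<xi>0 * of_real (LBINT \<xi>. \<phi> \<xi>) = (LBINT \<xi>. h \<xi>0 * of_real (\<phi> \<xi>))"
    by (simp add: integral_bounded_linear[OF bounded_linear_of_real \<phi>_int])
  also have "\<dots> = (LBINT \<xi>. h \<xi>0 * of_real (\<phi> \<xi>)) - (LBINT \<xi>. h \<xi> * of_real (\<phi> \<xi>))"
    using null_cont[OF \<phi>_cont] by simp
  also have "\<dots> = (LBINT \<xi>. h \<xi>0 * of_real (\<phi> \<xi>) - h \<xi> * of_real (\<phi> \<xi>))"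
    by (rule Bochner_Integration.integral_diff[OF int2 int1, symmetric])
  also have "norm \<dots> \<le> (LBINT \<xi>. c * \<phi> \<xi>)"
  proof (rule Bochner_Integration.integral_norm_bound_integral)
    show "integrable lborel (\<lambda>\<xi>. h \<xi>0 * of_real (\<phi> \<xi>) - h \<xi> * of_real (\<phi> \<xi>))"
      by (intro Bochner_Integration.integrable_diff int1 int2)
    show "integrable lborel (\<lambda>\<xi>. c * \<phi> \<xi>)" using \<phi>_int by simp
    fix \<xi>
    show "norm (h \<xi>0 * of_real (\<phi> \<xi>) - h \<xi> * of_real (\<phi> \<xi>)) \<le> c * \<phi> \<xi>"
    proof (cases "\<bar>\<xi> - \<xi>0\<bar> < \<delta>")
      case True
      have "norm (h \<xi>0 * of_real (\<phi> \<xi>) - h \<xi> * of_real (\<phi> \<xi>)) = norm (h \<xi> - h \<xi>0) * \<phi> \<xi>"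
        by (simp flip: left_diff_distrib add: norm_mult norm_minus_commute \<phi>_def)
      also have "\<dots> \<le> c * \<phi> \<xi>"
        using \<delta>(2)[OF True] by (intro mult_right_mono) (auto simp: \<phi>_def)
      finally show ?thesis .
    qed (simp add: \<phi>_def)
  qed
  finally have "norm (h \<xi>0) * (LBINT \<xi>. \<phi> \<xi>) \<le> c * (LBINT \<xi>. \<phi> \<xi>)"
    using pos by (simp add: norm_mult)
  then show False using pos nz by (simp add: c_def mult_le_0_iff)
qed

lemma smooth_real_polynomial_function:
  "real_polynomial_function q \<Longrightarrow> smooth (\<lambda>x. of_real (q x) :: 'k::real_normed_field)"
proof (induction rule: real_polynomial_function.induct)
  case (linear f)
  then obtain c where "f = (\<lambda>x. x * c)"
    using real_bounded_linear by blast
  then show ?case by (auto intro!: smooth_mult smooth_const smooth_of_real)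
qed (auto intro: smooth_intros)

lemma isCont_of_bool_le:
  assumes "\<xi>0 \<noteq> (c::real)"
  shows "isCont (\<lambda>\<xi>. of_bool (c \<le> \<xi>) :: 'k::real_normed_field) \<xi>0"
    and "isCont (\<lambda>\<xi>. of_bool (\<xi> \<le> c) :: 'k::real_normed_field) \<xi>0"
proof -
  have ev: "\<forall>\<^sub>F \<xi> in nhds \<xi>0. (c \<le> \<xi> \<longleftrightarrow> c \<le> \<xi>0) \<and> (\<xi> \<le> c \<longleftrightarrow> \<xi>0 \<le> c)"
  proof (cases "c < \<xi>0")
    case True
    then have "\<forall>\<^sub>F \<xi> in nhds \<xi>0. \<xi> \<in> {c<..}" by (intro eventually_nhds_in_open) auto
    then show ?thesis by eventually_elim (use True in auto)
  next
    case False
    then have "\<forall>\<^sub>F \<xi> in nhds \<xi>0. \<xi> \<in> {..<c}" using assms by (intro eventually_nhds_in_open) auto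
    then show ?thesis by eventually_elim (use False assms in auto)
  qed
  have "\<forall>\<^sub>F \<xi> in nhds \<xi>0. of_bool (c \<le> \<xi>) = (of_bool (c \<le> \<xi>0) :: 'k)"
    using ev by eventually_elim auto
  then show "isCont (\<lambda>\<xi>. of_bool (c \<le> \<xi>) :: 'k) \<xi>0"
    by (subst isCont_cong) auto
  have "\<forall>\<^sub>F \<xi> in nhds \<xi>0. of_bool (\<xi> \<le> c) = (of_bool (\<xi>0 \<le> c) :: 'k)"
    using ev by eventually_elim auto
  then show "isCont (\<lambda>\<xi>. of_bool (\<xi> \<le> c) :: 'k) \<xi>0"
    by (subst isCont_cong) auto
qed

lemma isCont_fst_kernel_of:
  fixes ops :: "'k::{real_normed_field,euclidean_space} elem_op list"
  assumes "\<forall>p\<in>set ops. smooth_op p" "\<xi>0 \<notin> insert x (op_point ` set ops)"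
  shows "isCont (\<lambda>\<xi>. fst (kernel_of ops) x \<xi>) \<xi>0"
  using assms
proof (induction ops)
  case Nil
  then show ?case by (simp add: kernel_of_def)
next
  case (Cons p ops)
  have "isCont (\<lambda>\<xi>. fst (op_kernel p) x \<xi>) \<xi>0"
  proof (cases p)
    case (IntegOp f \<alpha> g)
    have g: "isCont g \<xi>0"
      using smooth_continuous_on[of g UNIV] Cons.prems IntegOp
      by (auto simp: continuous_on_eq_continuous_at)
    have ne: "\<xi>0 \<noteq> \<alpha>" "\<xi>0 \<noteq> x" using Cons.prems IntegOp by auto
    show ?thesis
      unfolding IntegOp op_kernel.simps fst_conv of_bool_conj
      by (intro isCont_diff isCont_mult continuous_const g isCont_of_bool_le ne)
  qed simp
  moreover have "isCont (\<lambda>\<xi>. fst (kernel_of ops) x \<xi>) \<xi>0" using Cons by simp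
  ultimately show ?case by (simp add: fst_kernel_of)
qed

lemma fst_kernel_of_bounded_support:
  "\<exists>R. \<forall>\<xi>. \<xi> \<notin> {-R..R} \<longrightarrow> fst (kernel_of ops) x \<xi> = 0"
proof (induction ops)
  case Nil
  then show ?case by (simp add: kernel_of_def)
next
  case (Cons p ops)
  then obtain R where R: "\<forall>\<xi>. \<xi> \<notin> {-R..R} \<longrightarrow> fst (kernel_of ops) x \<xi> = 0" by blast
  obtain \<rho> where \<rho>: "R \<le> \<rho>" "\<bar>op_point p\<bar> \<le> \<rho>" "\<bar>x\<bar> \<le> \<rho>"
    using that[of "max R (max \<bar>op_point p\<bar> \<bar>x\<bar>)"] by simp
  show ?case
  proof (intro exI[of _ \<rho>] allI impI)
    fix \<xi> assume \<xi>: "\<xi> \<notin> {-\<rho>..\<rho>}"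
    have "fst (op_kernel p) x \<xi> = 0"
      using \<xi> \<rho>(2,3) by (cases p) auto
    moreover have "fst (kernel_of ops) x \<xi> = 0"
      using \<xi> \<rho>(1) by (intro R[rule_format]) auto
    ultimately show "fst (kernel_of (p # ops)) x \<xi> = 0"
      by (simp add: fst_kernel_of)
  qed
qed

text \<open>
  Test functions of the form \<open>r q\<close>,
  with a fixed polynomial \<open>r\<close> killing all the Dirac terms and \<open>q\<close> an arbitrary polynomial, see the
  functional part only; so \<open>r\<close> times this part has zero moments and is zero at its points of
  continuity. Once the functional part is known to be zero almost everywhere, the Dirac terms alone
  give zero on all test functions, and they are independent.
\<close>

lemma kernel_of_null_operator:
  fixes ops :: "'k::{real_normed_field,euclidean_space} elem_op list"
  assumes ops: "\<forall>p\<in>set ops. smooth_op p"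
    and null: "\<And>f. smooth f \<Longrightarrow> op_sum ops f x = 0"
  shows "finite {\<xi>. fst (kernel_of ops) x \<xi> \<noteq> 0}" and "snd (kernel_of ops) \<alpha> i x = 0"
proof -
  let ?K = "fst (kernel_of ops) x" and ?P = "\<Union>p\<in>set ops. eval_orders p"
  let ?e = "\<lambda>\<alpha> i. snd (kernel_of ops) \<alpha> i x * (-1) ^ i"
  have action: "(LBINT \<xi>. ?K \<xi> * f \<xi>) + (\<Sum>(\<alpha>, i)\<in>?P. ?e \<alpha> i * (ddx ^^ i) f \<alpha>) = 0"
    if "smooth f" for f
    using op_sum_eq_kernel_action[of UNIV x ops f] ops that null[OF that]
    by (simp add: set_lebesgue_integral_def mult.assoc)
  obtain R where R: "\<And>\<xi>. \<xi> \<notin> {-R..R} \<Longrightarrow> ?K \<xi> = 0"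
    using fst_kernel_of_bounded_support[of ops x] by blast
  have K_int: "integrable lborel ?K"
    using integral_fst_kernel_of[of UNIV x ops "\<lambda>_. 1"] ops by (simp add: smooth_const set_integrable_def)
  have finP: "finite ?P" by (rule finite_eval_orders)
  then obtain N where N: "\<forall>j\<in>snd ` ?P. j < N"
    using finite_nat_set_iff_bounded by blast
  define B where "B = fst ` ?P"
  have "finite B" using finP by (simp add: B_def)
  define r where "r \<xi> = (\<Prod>\<beta>\<in>B. (of_real \<xi> - of_real \<beta> :: 'k) ^ N)" for \<xi>
  have smr: "smooth r" unfolding r_def by (rule smooth_root_product)
  have zero: "?K \<xi>0 = 0" if "\<xi>0 \<notin> insert x (op_point ` set ops) \<union> B" for \<xi>0
  proof -
    have "?K \<xi>0 * r \<xi>0 = 0"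
    proof (rule polynomial_moments_zero[where R=R])
      show "integrable lborel (\<lambda>\<xi>. ?K \<xi> * r \<xi>)"
        by (rule integrable_mult_continuous[OF K_int R smooth_continuous_on[OF smr]])
      show "?K \<xi> * r \<xi> = 0" if "\<xi> \<notin> {-R..R}" for \<xi> using R[OF that] by simp
      show "isCont (\<lambda>\<xi>. ?K \<xi> * r \<xi>) \<xi>0"
        using isCont_fst_kernel_of[OF ops, of \<xi>0 x] that smooth_continuous_on[OF smr, of UNIV]
        by (intro isCont_mult) (auto simp: continuous_on_eq_continuous_at)
      show "(LBINT \<xi>. ?K \<xi> * r \<xi> * of_real (q \<xi>)) = 0" if q: "real_polynomial_function q" for q
      proof -
        have smq: "smooth (\<lambda>\<xi>. of_real (q \<xi>) :: 'k)" by (rule smooth_real_polynomial_function[OF q])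
        have vanish: "(ddx ^^ i) (\<lambda>\<xi>. r \<xi> * of_real (q \<xi>)) \<alpha> = 0" if "(\<alpha>, i) \<in> ?P" for \<alpha> i
        proof -
          have "\<alpha> \<in> B" "i < N" using that N by (force simp: B_def)+
          then show ?thesis unfolding r_def by (rule ddx_funpow_root_product[OF \<open>finite B\<close> _ _ smq])
        qed
        have "(\<Sum>(\<alpha>, i)\<in>?P. ?e \<alpha> i * (ddx ^^ i) (\<lambda>\<xi>. r \<xi> * of_real (q \<xi>)) \<alpha>) = 0"
        proof (intro sum.neutral ballI)
          fix z assume "z \<in> ?P"
          then show "(case z of (\<alpha>, i) \<Rightarrow> ?e \<alpha> i * (ddx ^^ i) (\<lambda>\<xi>. r \<xi> * of_real (q \<xi>)) \<alpha>) = 0"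
            using vanish[of "fst z" "snd z"] by (simp add: split_def del: UN_iff)
        qed
        then show ?thesis
          using action[OF smooth_mult[OF smr smq]] by (simp add: mult.assoc)
      qed
    qed
    moreover have "r \<xi>0 \<noteq> 0" using that \<open>finite B\<close> by (auto simp: r_def)
    ultimately show ?thesis by simp
  qed
  have "{\<xi>. ?K \<xi> \<noteq> 0} \<subseteq> insert x (op_point ` set ops) \<union> B" using zero by blast
  then show fin: "finite {\<xi>. ?K \<xi> \<noteq> 0}"
    by (rule finite_subset) (simp add: \<open>finite B\<close>)
  have "(LBINT \<xi>. ?K \<xi> * f \<xi>) = 0" for f
  proof (rule integral_eq_zero_AE)
    have "AE \<xi> in lborel. \<xi> \<notin> {\<xi>. ?K \<xi> \<noteq> 0}"
      using fin by (intro AE_not_in finite_imp_null_set_lborel)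
    then show "AE \<xi> in lborel. ?K \<xi> * f \<xi> = 0" by eventually_elim simp
  qed
  then have dirac_null: "(\<Sum>(\<alpha>, i)\<in>?P. ?e \<alpha> i * (ddx ^^ i) f \<alpha>) = 0" if "smooth f" for f
    using action[OF that] by simp
  show "snd (kernel_of ops) \<alpha> i x = 0"
  proof (cases "(\<alpha>, i) \<in> ?P")
    case True
    then show ?thesis using dirac_derivatives_independent[OF finP dirac_null] by auto
  next
    case False
    then show ?thesis using snd_kernel_of_nonzero by blast
  qed
qed

text \<open>
  Kernels depend linearly on the list of operators; this reduces the comparison of two representations
  of an operator to the representations of zero.
\<close>

lemma kernel_of_append_negative:
  "fst (kernel_of (ops @ map (scale_op (\<lambda>_. -1)) ops')) x \<xi> = fst (kernel_of ops) x \<xi> - fst (kernel_of ops') x \<xi>"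
  "snd (kernel_of (ops @ map (scale_op (\<lambda>_. -1)) ops')) \<alpha> i x = snd (kernel_of ops) \<alpha> i x - snd (kernel_of ops') \<alpha> i x"
proof -
  have 1: "fst (op_kernel (scale_op (\<lambda>_. -1) p)) x \<xi> = - fst (op_kernel p) x \<xi>"
    "snd (op_kernel (scale_op (\<lambda>_. -1) p)) \<alpha> i x = - snd (op_kernel p) \<alpha> i x" for p
    by (cases p; auto simp: dirac_def)+
  have "fst (kernel_of (map (scale_op (\<lambda>_. -1)) ops')) x \<xi> = - fst (kernel_of ops') x \<xi>"
    "snd (kernel_of (map (scale_op (\<lambda>_. -1)) ops')) \<alpha> i x = - snd (kernel_of ops') \<alpha> i x"
    unfolding fst_kernel_of snd_kernel_of by (induction ops') (simp_all add: 1)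
  then show "fst (kernel_of (ops @ map (scale_op (\<lambda>_. -1)) ops')) x \<xi> = fst (kernel_of ops) x \<xi> - fst (kernel_of ops') x \<xi>"
  "snd (kernel_of (ops @ map (scale_op (\<lambda>_. -1)) ops')) \<alpha> i x = snd (kernel_of ops) \<alpha> i x - snd (kernel_of ops') \<alpha> i x"
    by (simp_all add: fst_kernel_of snd_kernel_of)
qed

text \<open>
  The difference of the two representations is a representation of zero. The two sums may use different
  points, also points outside \<open>J\<close>, because the null operator is tested on functions on the whole line.
\<close>

lemma kernel_eq_kernel_of:
  assumes "\<forall>p\<in>set ops. smooth_op p" "\<forall>p\<in>set ops'. smooth_op p"
    and eq: "\<And>f. smooth f \<Longrightarrow> op_sum ops f = op_sum ops' f"
  shows "kernel_eq J (kernel_of ops) (kernel_of ops')"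
proof -
  let ?d = "ops @ map (scale_op (\<lambda>_. -1)) ops'"
  have sm: "\<forall>p\<in>set ?d. smooth_op p"
    using assms(1,2) by (auto intro: smooth_op_scale_op smooth_const)
  have "op_sum ?d f x = op_sum ops f x + op_sum (map (scale_op (\<lambda>_. -1)) ops') f x" for f x
    by (simp add: op_sum_def)
  then have null: "op_sum ?d f x = 0" if "smooth f" for f x
    using eq[OF that] by (simp add: op_sum_scale_op)
  show ?thesis
    unfolding kernel_eq_def
  proof (intro ballI conjI allI)
    fix x \<alpha> i
    show "finite {\<xi>\<in>J. fst (kernel_of ops) x \<xi> \<noteq> fst (kernel_of ops') x \<xi>}"
      by (rule finite_subset[OF _ kernel_of_null_operator(1)[OF sm null, of x]])
         (auto simp: kernel_of_append_negative)
    show "snd (kernel_of ops) \<alpha> i x = snd (kernel_of ops') \<alpha> i x"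
      using kernel_of_null_operator(2)[OF sm null, where x=x and \<alpha>=\<alpha> and i=i] by (simp add: kernel_of_append_negative)
  qed
qed

section \<open>The form of the Green's function\<close>

lemma greens_function_kernel_of:
  assumes "\<forall>p\<in>set ops. smooth_op p \<and> op_point p \<in> J" "is_interval J"
    and "\<And>f. smooth f \<Longrightarrow> greens_operator cs \<beta>s f = op_sum ops f"
  shows "greens_function J cs \<beta>s (kernel_of ops)"
  unfolding greens_function_def
proof (intro conjI exI[of _ ops] allI impI ballI)
  show "smooth_op p" if "p \<in> set ops" for p using assms(1) that by blast
  fix f :: "real \<Rightarrow> 'a" assume f: "smooth f"
  show "greens_operator cs \<beta>s f = (\<lambda>x. \<Sum>p\<leftarrow>ops. op_apply p f x)"
    using assms(3)[OF f] by (simp add: op_sum_def)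
  fix x assume "x \<in> J"
  show "set_integrable lborel J (\<lambda>\<xi>. fst (kernel_of ops) x \<xi> * f \<xi>)"
    using integral_fst_kernel_of[OF assms(2) \<open>x \<in> J\<close> assms(1) f] by blast
  show "greens_operator cs \<beta>s f x = kernel_integral J (kernel_of ops) f x"
    using kernel_integral_kernel_of[OF assms(2) \<open>x \<in> J\<close> assms(1) f] assms(3)[OF f] by simp
qed simp

theorem theorem4:
  fixes n :: nat
    and cs :: "(real \<Rightarrow> 'k::{real_normed_field,euclidean_space}) list"
    and \<beta>s :: "'k stieltjes list"
    and \<alpha>s :: "real list"
    and J :: "real set"
  assumes "0 < n"
    and "boundary_problem n cs \<beta>s"
    and "regular_problem cs \<beta>s"
    and "sorted_wrt (<) \<alpha>s"
    and "set \<alpha>s = (\<Union>\<beta>\<in>set \<beta>s. eval_points \<beta>)"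
    and "is_interval J"
    and "set \<alpha>s \<subseteq> J"
  shows "(\<exists>g. greens_function J cs \<beta>s g) \<and>
    (\<forall>g. greens_function J cs \<beta>s g \<longrightarrow>
      (\<exists>g_fun g_dist. kernel_eq J g (g_fun, g_dist) \<and>
         case_branches \<alpha>s J g_fun \<and> outer_branches \<alpha>s J g_fun \<and>
         dirac_combination \<alpha>s g_dist))"
proof -
  obtain ops where ops: "\<forall>p\<in>set ops. smooth_op p \<and> op_point p \<in> set \<alpha>s"
    and G: "\<And>f. smooth f \<Longrightarrow> greens_operator cs \<beta>s f = op_sum ops f"
    using green_form_greens_operator[OF assms(1-3)] unfolding green_form_def assms(5) by blast
  have "greens_function J cs \<beta>s (kernel_of ops)"
    by (rule greens_function_kernel_of) (use ops G assms(6,7) in auto)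
  moreover have "\<exists>g_fun g_dist. kernel_eq J g (g_fun, g_dist) \<and> case_branches \<alpha>s J g_fun \<and>
      outer_branches \<alpha>s J g_fun \<and> dirac_combination \<alpha>s g_dist"
    if g: "greens_function J cs \<beta>s g" for g
  proof -
    obtain ops' where ops': "\<forall>p\<in>set ops'. smooth_op p" "g = kernel_of ops'"
      and G': "\<And>f. smooth f \<Longrightarrow> greens_operator cs \<beta>s f = op_sum ops' f"
      using g unfolding greens_function_def op_sum_def by blast
    have "kernel_eq J g (kernel_of ops)"
      unfolding ops'(2) by (rule kernel_eq_kernel_of) (use ops ops' G G' in auto)
    then show ?thesis
      using case_branches_kernel_of[OF assms(4) ops, of J] outer_branches_kernel_of[OF assms(4) ops, of J]
        dirac_combination_kernel_of[OF assms(4) ops]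
      by (intro exI[of _ "fst (kernel_of ops)"] exI[of _ "snd (kernel_of ops)"]) auto
  qed
  ultimately show ?thesis by blast
qed

end
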